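(* Let $n,q$ be coprime integers with $1<q<n$, let $\frac{n}{n-q}=[a_2,\dots,a_{e-1}]$ be the Hirzebruch-Jung expansion, and assume $e\ge4$. Let $R_{n,q}$ be the invariant ring of the dihedral quotient singularity $\mathbb D_{n,q}$, with Riemenschneider's generators $z_1,\dots,z_e$, and let $s_3,\widehat s_3,\alpha,\beta$ be as in the context. Put $x=z_1$, $y=z_{e-1}$, $z=z_e$. Then the projection of $\operatorname{Spec}(R_{n,q})\subset\mathbb C^e$ onto these three coordinates has image $\overline X_{n,q}=V(F)\subset\mathbb C^3$, the zero set of $$F=y^{2\alpha+2s_3}+x^{a_2-1}y^{2\alpha}z^{2\widehat s_3}-xz^{2\beta+2\widehat s_3}.$$ In particular, the local ring of $\overline X_{n,q}$ at the origin is $\overline R_{n,q}=\mathbb C[x,y,z]_{(x,y,z)}/(F)$, and the induced rational map $\operatorname{Spec}(R_{n,q})\dashrightarrow\operatorname{Spec}(\overline R_{n,q})$ is birational (i.e. it induces an isomorphism of fraction fields).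
   Context: $[c_1,\dots,c_m]=c_1-\cfrac{1}{c_2-\cfrac{1}{\ddots-\cfrac1{c_m}}}$, $c_i\ge2$. Ring: $R_{n,q}=\mathbb C[u,v]^{\mathcal D_{n,q}}$, where, with $m=n-q$ and $\varepsilon_k$ a primitive $k$-th root of unity, $\mathcal D_{n,q}\subset \mathrm{GL}(2,\mathbb C)$ is generated by $\psi_{2q},\tau,\varphi_{2m}$ if $m$ is odd and by $\psi_{2q},\tau\varphi_{4m}$ if $m$ is even; here $\psi_k=\operatorname{diag}(\varepsilon_k,\varepsilon_k^{-1})$, $\varphi_k=\operatorname{diag}(\varepsilon_k,\varepsilon_k)$, $\tau=\begin{pmatrix}0&\varepsilon_4\\ \varepsilon_4&0\end{pmatrix}$. By Riemenschneider, $R_{n,q}$ (a two-dimensional normal domain) has generators $z_1,\dots,z_e$ (suitably normalized by nonzero constants), all nonzero, whose ideal of relations is generated by $$z_2^2=z_1(z_3^2+z_1^{a_2-1}),$$ $$z_1z_i=z_2z_3^{a_3-2}\cdots z_{i-2}^{a_{i-2}-2}z_{i-1}^{a_{i-1}-1}\quad(4\le i\le e),$$ $$z_2z_i=z_3^{a_3-2}\cdots z_{i-2}^{a_{i-2}-2}z_{i-1}^{a_{i-1}-1}(z_3^2+z_1^{a_2-1})\quad(4\le i\le e),$$ $$z_{i-1}z_{i+1}=z_i^{a_i}\quad(4\le i\le e-1),$$ $$z_jz_i=z_{j+1}^{a_{j+1}-1}z_{j+2}^{a_{j+2}-2}\cdots z_{i-2}^{a_{i-2}-2}z_{i-1}^{a_{i-1}-1}\quad(4\le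 j+1<i-1\le e-1)$$ (for $i=4$ the first product is $z_2z_3^{a_3-1}$, and similarly for the second). Up to constants, $z_1=(uv)^{2(n-q)}$ and $z_j=v_1^{r_j}v_2^{c_j}v_3^{d_j}$ with $v_1=uv$, $v_2=u^{2q}+(-1)^{a_2}v^{2q}$, $v_3=u^{2q}+(-1)^{a_2-1}v^{2q}$, $(c_2,d_2,r_2)=(1,0,a_2(n-q)-q)$, $(c_3,d_3,r_3)=(0,1,r_2-(n-q))$, $(c_4,d_4,r_4)=(1,a_3-1,(a_3+1)r_3-r_2)$, and each of $c_j,d_j,r_j$ satisfies $t_j=a_{j-1}t_{j-1}-t_{j-2}$ for $5\le j\le e$. Exponents. For $e\ge5$: $s_e=0$, $s_{e-1}=1$, $s_{e-2}=a_{e-1}$, and $s_j=(a_{j+1}-1)s_{j+1}+(a_{j+2}-1)s_{j+2}-s_{j+3}$ for $3\le j\le e-3$; $\widehat s_{e-1}=0$, $\widehat s_{e-2}=1$, $\widehat s_{e-3}=a_{e-2}$, and $\widehat s_j=(a_{j+1}-1)\widehat s_{j+1}+(a_{j+2}-1)\widehat s_{j+2}-\widehat s_{j+3}$ for $3\le j\le e-4$; $\alpha=1+\sum_{j=3}^{e-1}(a_j-2)s_j$, $\beta=1+\sum_{j=3}^{e-2}(a_j-2)\widehat s_j$. For $e=4$: $s_3=1$, $\widehat s_3=0$, $\alpha=a_3-1$, $\beta=1$. *)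

theory Defs
  imports
    "HOL-Analysis.Analysis"
    "HOL-Library.Poly_Mapping"
    "HOL-Algebra.QuotRing"
    "HOL-Algebra.Generated_Groups"
begin

section \<open>Polynomials\<close>

text \<open>
  Polynomials over the complex numbers in the indeterminates $X_i$, $i \in \mathbb N$. The ring
  $\mathbb C[X_1,\dots,X_k]$ is the subring of those involving only $X_1,\dots,X_k$. The rings
  $\mathbb C[u,v]$, $\mathbb C[x,y,z]$ and $\mathbb C[Z_1,\dots,Z_e]$ are the cases $k = 2, 3, e$.
\<close>

type_synonym cpoly = "(nat \<Rightarrow>\<^sub>0 nat) \<Rightarrow>\<^sub>0 complex"

definition Var :: "nat \<Rightarrow> cpoly" where
  "Var i = Poly_Mapping.single (Poly_Mapping.single i 1) 1"

definition Const :: "complex \<Rightarrow> cpoly" where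
  "Const c = Poly_Mapping.single 0 c"

definition eval_hom :: "(complex \<Rightarrow> 'b::comm_ring_1) \<Rightarrow> (nat \<Rightarrow> 'b) \<Rightarrow> cpoly \<Rightarrow> 'b" where
  "eval_hom \<iota> h p =
     (\<Sum>m \<in> Poly_Mapping.keys p. \<iota> (Poly_Mapping.lookup p m) *
        (\<Prod>i \<in> Poly_Mapping.keys m. h i ^ Poly_Mapping.lookup m i))"

abbreviation eval_at :: "(nat \<Rightarrow> complex) \<Rightarrow> cpoly \<Rightarrow> complex" where
  "eval_at \<equiv> eval_hom (\<lambda>c. c)"

abbreviation subst_poly :: "(nat \<Rightarrow> cpoly) \<Rightarrow> cpoly \<Rightarrow> cpoly" where
  "subst_poly \<equiv> eval_hom Const"

definition poly_ring :: "nat \<Rightarrow> cpoly ring" where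
  "poly_ring k =
     \<lparr>carrier = {p. \<forall>m \<in> Poly_Mapping.keys p. Poly_Mapping.keys m \<subseteq> {1..k}},
      mult = (*), one = 1, zero = 0, add = (+)\<rparr>"


section \<open>Localization\<close>

text \<open>
  The localization $S^{-1}A$ of a commutative ring at a multiplicative set $S$, as the set of
  equivalence classes of pairs $(a,s)$.
\<close>

definition frac_rel :: "('a, 'm) ring_scheme \<Rightarrow> 'a set \<Rightarrow> (('a \<times> 'a) \<times> ('a \<times> 'a)) set" where
  "frac_rel A S = {((a, s), (b, t)). a \<in> carrier A \<and> b \<in> carrier A \<and> s \<in> S \<and> t \<in> S \<and>
     (\<exists>w \<in> S. w \<otimes>\<^bsub>A\<^esub> (a \<otimes>\<^bsub>A\<^esub> t) = w \<otimes>\<^bsub>A\<^esub> (b \<otimes>\<^bsub>A\<^esub> s))}"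

definition fraction :: "('a, 'm) ring_scheme \<Rightarrow> 'a set \<Rightarrow> 'a \<Rightarrow> 'a \<Rightarrow> ('a \<times> 'a) set" where
  "fraction A S a s = frac_rel A S `` {(a, s)}"

definition localization :: "('a, 'm) ring_scheme \<Rightarrow> 'a set \<Rightarrow> ('a \<times> 'a) set ring" where
  "localization A S =
     \<lparr>carrier = (carrier A \<times> S) // frac_rel A S,
      mult = (\<lambda>P Q. \<Union>(a, s) \<in> P. \<Union>(b, t) \<in> Q. fraction A S (a \<otimes>\<^bsub>A\<^esub> b) (s \<otimes>\<^bsub>A\<^esub> t)),
      one = fraction A S \<one>\<^bsub>A\<^esub> \<one>\<^bsub>A\<^esub>,
      zero = fraction A S \<zero>\<^bsub>A\<^esub> \<one>\<^bsub>A\<^esub>,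
      add = (\<lambda>P Q. \<Union>(a, s) \<in> P. \<Union>(b, t) \<in> Q.
               fraction A S ((a \<otimes>\<^bsub>A\<^esub> t) \<oplus>\<^bsub>A\<^esub> (b \<otimes>\<^bsub>A\<^esub> s)) (s \<otimes>\<^bsub>A\<^esub> t))\<rparr>"

definition frac_field :: "('a, 'm) ring_scheme \<Rightarrow> ('a \<times> 'a) set ring" where
  "frac_field A = localization A (carrier A - {\<zero>\<^bsub>A\<^esub>})"

definition to_frac_field :: "('a, 'm) ring_scheme \<Rightarrow> 'a \<Rightarrow> ('a \<times> 'a) set" where
  "to_frac_field A a = fraction A (carrier A - {\<zero>\<^bsub>A\<^esub>}) a \<one>\<^bsub>A\<^esub>"


section \<open>Affine varieties\<close>

definition affine_space :: "nat \<Rightarrow> (nat \<Rightarrow> complex) set" where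
  "affine_space k = {1..k} \<rightarrow>\<^sub>E UNIV"

definition zero_locus :: "nat \<Rightarrow> cpoly set \<Rightarrow> (nat \<Rightarrow> complex) set" where
  "zero_locus k P = {w \<in> affine_space k. \<forall>p \<in> P. eval_at w p = 0}"

definition vanishing_ideal :: "nat \<Rightarrow> (nat \<Rightarrow> complex) set \<Rightarrow> cpoly set" where
  "vanishing_ideal k V = {p \<in> carrier (poly_ring k). \<forall>w \<in> V. eval_at w p = 0}"

definition coord_ring :: "nat \<Rightarrow> (nat \<Rightarrow> complex) set \<Rightarrow> cpoly set ring" where
  "coord_ring k V = poly_ring k Quot vanishing_ideal k V"

definition coord_fun :: "nat \<Rightarrow> (nat \<Rightarrow> complex) set \<Rightarrow> cpoly \<Rightarrow> cpoly set" where
  "coord_fun k V p = vanishing_ideal k V +>\<^bsub>poly_ring k\<^esub> p"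

definition nonvanishing_at :: "nat \<Rightarrow> (nat \<Rightarrow> complex) \<Rightarrow> cpoly set" where
  "nonvanishing_at k w = {p \<in> carrier (poly_ring k). eval_at w p \<noteq> 0}"

text \<open>The local ring of the variety \<open>V\<close> at a point \<open>w\<close> of \<open>V\<close>, and the germ of a polynomial.\<close>

definition local_ring_at ::
  "nat \<Rightarrow> (nat \<Rightarrow> complex) set \<Rightarrow> (nat \<Rightarrow> complex) \<Rightarrow> (cpoly set \<times> cpoly set) set ring" where
  "local_ring_at k V w = localization (coord_ring k V) (coord_fun k V ` nonvanishing_at k w)"

definition germ_at ::
  "nat \<Rightarrow> (nat \<Rightarrow> complex) set \<Rightarrow> (nat \<Rightarrow> complex) \<Rightarrow> cpoly \<Rightarrow> (cpoly set \<times> cpoly set) set" where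
  "germ_at k V w p =
     fraction (coord_ring k V) (coord_fun k V ` nonvanishing_at k w)
       (coord_fun k V p) (coord_fun k V 1)"

definition origin :: "nat \<Rightarrow> nat \<Rightarrow> complex" where
  "origin k = (\<lambda>i \<in> {1..k}. 0)"

definition poly_ring_at_origin :: "nat \<Rightarrow> (cpoly \<times> cpoly) set ring" where
  "poly_ring_at_origin k = localization (poly_ring k) (nonvanishing_at k (origin k))"

definition poly_at_origin :: "nat \<Rightarrow> cpoly \<Rightarrow> (cpoly \<times> cpoly) set" where
  "poly_at_origin k p = fraction (poly_ring k) (nonvanishing_at k (origin k)) p 1"

text \<open>$\mathbb C[x,y,z]_{(x,y,z)}/(F)$ and the image in it of a polynomial.\<close>

definition R_bar :: "cpoly \<Rightarrow> (cpoly \<times> cpoly) set set ring" where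
  "R_bar F = poly_ring_at_origin 3 Quot (PIdl\<^bsub>poly_ring_at_origin 3\<^esub> (poly_at_origin 3 F))"

definition to_R_bar :: "cpoly \<Rightarrow> cpoly \<Rightarrow> (cpoly \<times> cpoly) set set" where
  "to_R_bar F p =
     (PIdl\<^bsub>poly_ring_at_origin 3\<^esub> (poly_at_origin 3 F)) +>\<^bsub>poly_ring_at_origin 3\<^esub> poly_at_origin 3 p"


section \<open>The dihedral groups and their invariant rings\<close>

definition primitive_root :: "nat \<Rightarrow> complex \<Rightarrow> bool" where
  "primitive_root k \<omega> \<longleftrightarrow> \<omega> ^ k = 1 \<and> (\<forall>j. 0 < j \<and> j < k \<longrightarrow> \<omega> ^ j \<noteq> 1)"

definition GL2 :: "(complex^2^2) monoid" where
  "GL2 = \<lparr>carrier = {A. invertible A}, mult = (**), one = mat 1\<rparr>"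

definition mat2 :: "complex \<Rightarrow> complex \<Rightarrow> complex \<Rightarrow> complex \<Rightarrow> complex^2^2" where
  "mat2 a b c d = vector [vector [a, b], vector [c, d]]"

text \<open>In the following, \<open>\<epsilon> k\<close> stands for the chosen primitive \<open>k\<close>-th root of unity.\<close>

definition psi :: "(nat \<Rightarrow> complex) \<Rightarrow> nat \<Rightarrow> complex^2^2" where
  "psi \<epsilon> k = mat2 (\<epsilon> k) 0 0 (inverse (\<epsilon> k))"

definition phi :: "(nat \<Rightarrow> complex) \<Rightarrow> nat \<Rightarrow> complex^2^2" where
  "phi \<epsilon> k = mat2 (\<epsilon> k) 0 0 (\<epsilon> k)"

definition tau :: "(nat \<Rightarrow> complex) \<Rightarrow> complex^2^2" where
  "tau \<epsilon> = mat2 0 (\<epsilon> 4) (\<epsilon> 4) 0"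

definition dihedral_group :: "(nat \<Rightarrow> complex) \<Rightarrow> nat \<Rightarrow> nat \<Rightarrow> (complex^2^2) set" where
  "dihedral_group \<epsilon> n q =
     (let m = n - q in
      generate GL2
        (if odd m then {psi \<epsilon> (2 * q), tau \<epsilon>, phi \<epsilon> (2 * m)}
         else {psi \<epsilon> (2 * q), tau \<epsilon> ** phi \<epsilon> (4 * m)}))"

text \<open>
  \<open>act_poly A f\<close> is $f(A\,(u,v)^{T})$. Here and below, $u$ and $v$ are \<open>Var 1\<close> and \<open>Var 2\<close>.
\<close>

definition act_poly :: "complex^2^2 \<Rightarrow> cpoly \<Rightarrow> cpoly" where
  "act_poly A =
     subst_poly (\<lambda>i. if i = 1 then Const (A $ 1 $ 1) * Var 1 + Const (A $ 1 $ 2) * Var 2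
                     else Const (A $ 2 $ 1) * Var 1 + Const (A $ 2 $ 2) * Var 2)"

definition invariant_ring :: "(nat \<Rightarrow> complex) \<Rightarrow> nat \<Rightarrow> nat \<Rightarrow> cpoly ring" where
  "invariant_ring \<epsilon> n q =
     (poly_ring 2)\<lparr>carrier := {f \<in> carrier (poly_ring 2). \<forall>A \<in> dihedral_group \<epsilon> n q. act_poly A f = f}\<rparr>"


section \<open>Riemenschneider's generators\<close>

fun hj_fraction :: "nat list \<Rightarrow> rat" where
  "hj_fraction [] = 0"
| "hj_fraction [c] = of_nat c"
| "hj_fraction (c # d # cs) = of_nat c - 1 / hj_fraction (d # cs)"

text \<open>$x = [a_2,\dots,a_{e-1}]$ with all $a_j \ge 2$; only these values of \<open>a\<close> matter.\<close>

definition is_hj_expansion :: "rat \<Rightarrow> (nat \<Rightarrow> nat) \<Rightarrow> nat \<Rightarrow> bool" where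
  "is_hj_expansion x a e \<longleftrightarrow>
     3 \<le> e \<and> (\<forall>j \<in> {2..<e}. 2 \<le> a j) \<and> hj_fraction (map a [2..<e]) = x"

text \<open>The sequence with given values at 2, 3, 4 and $t_j = a_{j-1}t_{j-1} - t_{j-2}$ for $j \ge 5$.\<close>

fun rec_seq :: "(nat \<Rightarrow> nat) \<Rightarrow> int \<Rightarrow> int \<Rightarrow> int \<Rightarrow> nat \<Rightarrow> int" where
  "rec_seq a t2 t3 t4 j =
     (if j \<le> 2 then t2 else if j = 3 then t3 else if j = 4 then t4
      else int (a (j - 1)) * rec_seq a t2 t3 t4 (j - 1) - rec_seq a t2 t3 t4 (j - 2))"

declare rec_seq.simps [simp del]

definition c_seq :: "(nat \<Rightarrow> nat) \<Rightarrow> nat \<Rightarrow> int" where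
  "c_seq a = rec_seq a 1 0 1"

definition d_seq :: "(nat \<Rightarrow> nat) \<Rightarrow> nat \<Rightarrow> int" where
  "d_seq a = rec_seq a 0 1 (int (a 3) - 1)"

definition r_seq :: "nat \<Rightarrow> nat \<Rightarrow> (nat \<Rightarrow> nat) \<Rightarrow> nat \<Rightarrow> int" where
  "r_seq n q a =
     (let r2 = int (a 2) * (int n - int q) - int q; r3 = r2 - (int n - int q)
      in rec_seq a r2 r3 ((int (a 3) + 1) * r3 - r2))"

text \<open>The generators before normalization; the exponents are nonnegative for $2 \le j \le e$.\<close>

definition raw_gen :: "nat \<Rightarrow> nat \<Rightarrow> (nat \<Rightarrow> nat) \<Rightarrow> nat \<Rightarrow> cpoly" where
  "raw_gen n q a j =
     (let v1 = Var 1 * Var 2;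
          v2 = Var 1 ^ (2 * q) + (- 1) ^ a 2 * Var 2 ^ (2 * q);
          v3 = Var 1 ^ (2 * q) + (- 1) ^ (a 2 - 1) * Var 2 ^ (2 * q)
      in if j = 1 then v1 ^ (2 * (n - q))
         else v1 ^ nat (r_seq n q a j) * v2 ^ nat (c_seq a j) * v3 ^ nat (d_seq a j))"

text \<open>
  \<open>tail_prod a l i\<close> is $Z_l^{a_l-2}\cdots Z_{i-2}^{a_{i-2}-2}\,Z_{i-1}^{a_{i-1}-1}$;
  for $l > i - 2$ it is just the last factor.
\<close>

definition tail_prod :: "(nat \<Rightarrow> nat) \<Rightarrow> nat \<Rightarrow> nat \<Rightarrow> cpoly" where
  "tail_prod a l i = (\<Prod>k = l..i - 2. Var k ^ (a k - 2)) * Var (i - 1) ^ (a (i - 1) - 1)"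

definition riemenschneider_relations :: "(nat \<Rightarrow> nat) \<Rightarrow> nat \<Rightarrow> cpoly set" where
  "riemenschneider_relations a e =
     {Var 2 ^ 2 - Var 1 * (Var 3 ^ 2 + Var 1 ^ (a 2 - 1))}
     \<union> {Var 1 * Var i - Var 2 * tail_prod a 3 i | i. 4 \<le> i \<and> i \<le> e}
     \<union> {Var 2 * Var i - tail_prod a 3 i * (Var 3 ^ 2 + Var 1 ^ (a 2 - 1)) | i. 4 \<le> i \<and> i \<le> e}
     \<union> {Var (i - 1) * Var (i + 1) - Var i ^ a i | i. 4 \<le> i \<and> i \<le> e - 1}
     \<union> {Var j * Var i - Var (j + 1) ^ (a (j + 1) - 1) * tail_prod a (j + 2) i | j i.
          4 \<le> j + 1 \<and> j + 1 < i - 1 \<and> i - 1 \<le> e - 1}"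

definition relation_ideal :: "nat \<Rightarrow> (nat \<Rightarrow> cpoly) \<Rightarrow> cpoly set" where
  "relation_ideal e z = {p \<in> carrier (poly_ring e). subst_poly z p = 0}"

text \<open>
  The family $z_1,\dots,z_e$ consists of nonzero multiples of the explicit invariants, it generates
  the invariant ring as an algebra, and its ideal of relations is generated by Riemenschneider's
  equations (which is what normalizes the constants).
\<close>

definition riemenschneider_generators ::
  "(nat \<Rightarrow> complex) \<Rightarrow> nat \<Rightarrow> nat \<Rightarrow> (nat \<Rightarrow> nat) \<Rightarrow> nat \<Rightarrow> (nat \<Rightarrow> cpoly) \<Rightarrow> bool" where
  "riemenschneider_generators \<epsilon> n q a e z \<longleftrightarrow>
     (\<forall>j \<in> {1..e}. \<exists>\<kappa>. \<kappa> \<noteq> 0 \<and> z j = Const \<kappa> * raw_gen n q a j) \<and>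
     subst_poly z ` carrier (poly_ring e) = carrier (invariant_ring \<epsilon> n q) \<and>
     relation_ideal e z = Idl\<^bsub>poly_ring e\<^esub> (riemenschneider_relations a e)"

text \<open>$\operatorname{Spec} R_{n,q} \subset \mathbb C^e$, embedded by the generators.\<close>

definition embedded_spec :: "nat \<Rightarrow> (nat \<Rightarrow> cpoly) \<Rightarrow> (nat \<Rightarrow> complex) set" where
  "embedded_spec e z = zero_locus e (relation_ideal e z)"

text \<open>The entries number $1$, $e-1$, $e$ of a family, as a family indexed by $1,2,3$.\<close>

definition proj3 :: "nat \<Rightarrow> (nat \<Rightarrow> 'b) \<Rightarrow> nat \<Rightarrow> 'b" where
  "proj3 e w = (\<lambda>i \<in> {1..3}. if i = 1 then w 1 else if i = 2 then w (e - 1) else w e)"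


definition X_bar :: "nat \<Rightarrow> (nat \<Rightarrow> cpoly) \<Rightarrow> (nat \<Rightarrow> complex) set" where
  "X_bar e z = proj3 e ` embedded_spec e z"


section \<open>The exponents\<close>

function s_exp :: "(nat \<Rightarrow> nat) \<Rightarrow> nat \<Rightarrow> nat \<Rightarrow> int" where
  "s_exp a e j =
     (if e \<le> j then 0 else if e = j + 1 then 1 else if e = j + 2 then int (a (e - 1))
      else (int (a (j + 1)) - 1) * s_exp a e (j + 1) + (int (a (j + 2)) - 1) * s_exp a e (j + 2)
           - s_exp a e (j + 3))"
  by pat_completeness auto
termination by (relation "Wellfounded.measure (\<lambda>(a, e, j). e - j)") auto

declare s_exp.simps [simp del]

text \<open>
  The numbers $\widehat s_j$ are defined by the same recursion as the $s_j$ with $e$ replaced by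
  $e-1$. For $e=4$ this gives the stipulated values $s_3=1$, $\widehat s_3=0$, and the formulas for
  $\alpha$, $\beta$ below give $\alpha=a_3-1$, $\beta=1$.
\<close>

definition s_hat :: "(nat \<Rightarrow> nat) \<Rightarrow> nat \<Rightarrow> nat \<Rightarrow> int" where
  "s_hat a e j = s_exp a (e - 1) j"

definition alpha :: "(nat \<Rightarrow> nat) \<Rightarrow> nat \<Rightarrow> int" where
  "alpha a e = 1 + (\<Sum>j = 3..e - 1. (int (a j) - 2) * s_exp a e j)"

definition beta :: "(nat \<Rightarrow> nat) \<Rightarrow> nat \<Rightarrow> int" where
  "beta a e = 1 + (\<Sum>j = 3..e - 2. (int (a j) - 2) * s_hat a e j)"

lemma exponents_e4:
  "s_exp a 4 3 = 1" "s_hat a 4 3 = 0" "alpha a 4 = int (a 3) - 1" "beta a 4 = 1"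
  by (simp_all add: s_hat_def alpha_def beta_def s_exp.simps)

text \<open>
  The polynomial $F$ in $x, y, z$, which are \<open>Var 1\<close>, \<open>Var 2\<close>, \<open>Var 3\<close>;
  all exponents are nonnegative.
\<close>

definition F_poly :: "(nat \<Rightarrow> nat) \<Rightarrow> nat \<Rightarrow> cpoly" where
  "F_poly a e =
     Var 2 ^ nat (2 * alpha a e + 2 * s_exp a e 3)
     + Var 1 ^ (a 2 - 1) * Var 2 ^ nat (2 * alpha a e) * Var 3 ^ nat (2 * s_hat a e 3)
     - Var 1 * Var 3 ^ nat (2 * beta a e + 2 * s_hat a e 3)"

end

theory Submission
  imports Defs
begin

text \<open>
  Let \<open>h\<close> be the triple $(z_1, z_{e-1}, z_e)$ and $\varphi \colon \mathbb C[x,y,z] \to \mathbb C[u,v]$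
  the substitution homomorphism. The relations $z_{i-1}z_{i+1} = z_i^{a_i}$ give
  $z_j z_e^{\widehat s_j} = z_{e-1}^{s_j}$, then the relation for $z_1 z_e$ gives
  $z_2 z_{e-1}^\alpha = z_1 z_e^\beta$, so that all $z_j$ are rational in \<open>h\<close>, and the
  relation for $z_2^2$ becomes $F(h) = 0$.

  No Nullstellensatz is needed: a polynomial vanishing on the image of $\operatorname{Spec} R_{n,q}$
  vanishes at \<open>h(u,v)\<close> for all \<open>u\<close>, \<open>v\<close>, so the vanishing ideal is $\ker\varphi$. It is generated
  by $F$: this polynomial is monic of degree $N = 2\alpha + 2s_3$ in \<open>y\<close>, so one can divide by it,
  and the monomials $x^k y^i z^l$ with $i < N$ have images with pairwise distinct initial monomials
  with respect to the order in \<open>u\<close>, then \<open>v\<close>. For this, the orders of vanishing of \<open>h\<close>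
  along $u = 0$ are $N\rho$, $\rho$ and $0$ for some $\rho > 0$, since $r_e = 0$ and $F(h) = 0$.
\<close>

section \<open>Localization\<close>

text \<open>Once ker \<phi> = (F) is known, every ring statement is reduced to products in C[u,v], a
  domain: fractions p/s and p'/s' agree exactly if \<phi>(p) \<phi>(s') = \<phi>(p') \<phi>(s). The
  rings to be compared are then images of one set of pairs of polynomials, with equal fibres and
  equal formulas for sum and product, and that \<open>R_bar F\<close> is a domain comes from the
  same criterion. The image is all of V(F), not merely dense in it, and this is shown by exhibiting
  preimages. Where yz is nonzero, the rational expressions for the z_j define a point, and all
  relations follow from a few of them by cancellation. Where y = 0, F leaves only xz = 0, and where
  y is nonzero but z = 0, F forces e = 4; there cancellation fails and separate points are given.
  The order in u alone cannot separate powers of z, as z_e has order 0 along u = 0. Powers of v do: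
  restricted to u = 0, z_e is a constant times a positive power of v.\<close>

lemma ring_iso_by_parametrization:
  fixes B :: "('b, 'm) ring_scheme" and C :: "('c, 'n) ring_scheme" and f :: "'t \<Rightarrow> 'b" and g :: "'t \<Rightarrow> 'c"
  assumes B: "carrier B = f ` T" and C: "carrier C = g ` T"
    and eq: "\<And>s t. s \<in> T \<Longrightarrow> t \<in> T \<Longrightarrow> f s = f t \<longleftrightarrow> g s = g t"
    and add: "\<And>s t. s \<in> T \<Longrightarrow> t \<in> T \<Longrightarrow>
      p s t \<in> T \<and> f s \<oplus>\<^bsub>B\<^esub> f t = f (p s t) \<and> g s \<oplus>\<^bsub>C\<^esub> g t = g (p s t)"
    and mult: "\<And>s t. s \<in> T \<Longrightarrow> t \<in> T \<Longrightarrow>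
      m s t \<in> T \<and> f s \<otimes>\<^bsub>B\<^esub> f t = f (m s t) \<and> g s \<otimes>\<^bsub>C\<^esub> g t = g (m s t)"
    and one: "k \<in> T" "f k = \<one>\<^bsub>B\<^esub>" "g k = \<one>\<^bsub>C\<^esub>"
  shows "\<exists>\<Psi> \<in> ring_iso B C. \<forall>t \<in> T. \<Psi> (f t) = g t"
proof
  \<comment> \<open>Any parameter of \<open>b\<close> will do: the fibres of \<open>f\<close> and
    \<open>g\<close> coincide, so the choice made by \<open>inv_into\<close> does not affect the
    value.\<close>
  define \<Psi> where "\<Psi> b = g (inv_into T f b)" for b
  have \<Psi>: "\<Psi> (f t) = g t" if "t \<in> T" for t
    unfolding \<Psi>_def using that eq by (metis f_inv_into_f imageI inv_into_into)
  then show "\<forall>t \<in> T. \<Psi> (f t) = g t" by blast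
  show "\<Psi> \<in> ring_iso B C"
  proof (rule ring_iso_memI)
    show "bij_betw \<Psi> (carrier B) (carrier C)"
    proof (rule bij_betw_imageI)
      show "inj_on \<Psi> (carrier B)" using B \<Psi> eq by (auto intro!: inj_onI)
      show "\<Psi> ` carrier B = carrier C" using B C \<Psi> by (auto simp: image_image)
    qed
  next
    fix x assume "x \<in> carrier B"
    then show "\<Psi> x \<in> carrier C" using B C \<Psi> by auto
  next
    fix x y assume "x \<in> carrier B" "y \<in> carrier B"
    then obtain s t where st: "s \<in> T" "t \<in> T" "x = f s" "y = f t" using B by auto
    then show "\<Psi> (x \<otimes>\<^bsub>B\<^esub> y) = \<Psi> x \<otimes>\<^bsub>C\<^esub> \<Psi> y" using mult[of s t] \<Psi> by simp
    show "\<Psi> (x \<oplus>\<^bsub>B\<^esub> y) = \<Psi> x \<oplus>\<^bsub>C\<^esub> \<Psi> y" using add[of s t] \<Psi> st by simp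
  next
    show "\<Psi> \<one>\<^bsub>B\<^esub> = \<one>\<^bsub>C\<^esub>" using one \<Psi> by metis
  qed
qed

locale mult_closed_set = cring A for A (structure) +
  fixes S
  assumes S_sub: "S \<subseteq> carrier A" and one_S: "\<one> \<in> S"
    and mult_S: "\<And>s t. s \<in> S \<Longrightarrow> t \<in> S \<Longrightarrow> s \<otimes> t \<in> S"
begin

abbreviation "L \<equiv> localization A S"
abbreviation "fr \<equiv> fraction A S"

lemma S_closed: "s \<in> S \<Longrightarrow> s \<in> carrier A"
  using S_sub by auto

lemma frac_rel_iff: "((a, s), (b, t)) \<in> frac_rel A S \<longleftrightarrow>
    a \<in> carrier A \<and> b \<in> carrier A \<and> s \<in> S \<and> t \<in> S \<and> (\<exists>w \<in> S. w \<otimes> (a \<otimes> t) = w \<otimes> (b \<otimes> s))"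
  by (simp add: frac_rel_def)

lemma equiv_frac_rel: "equiv (carrier A \<times> S) (frac_rel A S)"
proof (rule equivI)
  show "frac_rel A S \<subseteq> (carrier A \<times> S) \<times> (carrier A \<times> S)"
    by (auto simp: frac_rel_def)
  show "refl_on (carrier A \<times> S) (frac_rel A S)"
    using one_S by (auto simp: refl_on_def frac_rel_iff)
  show "sym (frac_rel A S)"
    by (auto simp: sym_def frac_rel_iff) (metis)+
  show "trans (frac_rel A S)"
  proof (rule transI)
    fix x y z assume xy: "(x, y) \<in> frac_rel A S" and yz: "(y, z) \<in> frac_rel A S"
    obtain a s b t c r where [simp]: "x = (a, s)" "y = (b, t)" "z = (c, r)" by (metis surj_pair)
    from xy obtain w where w: "w \<in> S" "w \<otimes> (a \<otimes> t) = w \<otimes> (b \<otimes> s)" by (auto simp: frac_rel_iff)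
    from yz obtain w' where w': "w' \<in> S" "w' \<otimes> (b \<otimes> r) = w' \<otimes> (c \<otimes> t)" by (auto simp: frac_rel_iff)
    have carr [simp]: "a \<in> carrier A" "b \<in> carrier A" "c \<in> carrier A" "s \<in> S" "t \<in> S" "r \<in> S"
      using xy yz by (auto simp: frac_rel_iff)
    note [simp] = S_closed[OF w(1)] S_closed[OF w'(1)] S_closed[OF carr(4)] S_closed[OF carr(5)] S_closed[OF carr(6)]
    \<comment> \<open>The witness contains the middle denominator \<open>t\<close> besides
      \<open>w\<close> and \<open>w'\<close>, since \<open>t\<close> is what links the two
      equations.\<close>
    have "w \<otimes> w' \<otimes> t \<otimes> (a \<otimes> r) = w' \<otimes> r \<otimes> (w \<otimes> (a \<otimes> t))" by (simp add: m_ac)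
    also have "\<dots> = w \<otimes> s \<otimes> (w' \<otimes> (b \<otimes> r))" unfolding w(2) by (simp add: m_ac)
    also have "\<dots> = w \<otimes> w' \<otimes> t \<otimes> (c \<otimes> s)" unfolding w'(2) by (simp add: m_ac)
    finally show "(x, z) \<in> frac_rel A S"
      using w(1) w'(1) mult_S by (auto simp: frac_rel_iff)
  qed
qed

lemma fraction_eq_iff:
  assumes "a \<in> carrier A" "b \<in> carrier A" "s \<in> S" "t \<in> S"
  shows "fr a s = fr b t \<longleftrightarrow> (\<exists>w \<in> S. w \<otimes> (a \<otimes> t) = w \<otimes> (b \<otimes> s))"
proof -
  have "fr a s = fr b t \<longleftrightarrow> ((a, s), (b, t)) \<in> frac_rel A S"
    unfolding fraction_def using eq_equiv_class_iff[OF equiv_frac_rel] assms by blast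
  then show ?thesis using assms by (simp add: frac_rel_iff)
qed

lemma fraction_eqI:
  assumes "a \<in> carrier A" "b \<in> carrier A" "s \<in> S" "t \<in> S" "a \<otimes> t = b \<otimes> s"
  shows "fr a s = fr b t"
  using assms one_S by (subst fraction_eq_iff) auto

lemma carrier_localization: "carrier L = {fr a s | a s. a \<in> carrier A \<and> s \<in> S}"
  by (auto simp: localization_def fraction_def quotient_def)

lemma fraction_closed: "a \<in> carrier A \<Longrightarrow> s \<in> S \<Longrightarrow> fr a s \<in> carrier L"
  by (auto simp: carrier_localization)

lemma mem_fraction_iff:
  assumes "a \<in> carrier A" "s \<in> S"
  shows "(b, t) \<in> fr a s \<longleftrightarrow> b \<in> carrier A \<and> t \<in> S \<and> fr b t = fr a s"
  using assms fraction_eq_iff[of a b s t] by (auto simp: fraction_def frac_rel_iff)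

text \<open>The operations of a localization are unions over all representatives. If equivalent
  representatives give the same result, the union runs over copies of one set and equals it; this is
  how well-definedness enters for sums and products.\<close>

lemma UN_fractions_const:
  assumes "a \<in> carrier A" "s \<in> S" "b \<in> carrier A" "t \<in> S"
    and "\<And>a' s' b' t'. a' \<in> carrier A \<Longrightarrow> s' \<in> S \<Longrightarrow> b' \<in> carrier A \<Longrightarrow> t' \<in> S \<Longrightarrow>
      fr a' s' = fr a s \<Longrightarrow> fr b' t' = fr b t \<Longrightarrow> h a' s' b' t' = h a s b t"
  shows "(\<Union>(a', s') \<in> fr a s. \<Union>(b', t') \<in> fr b t. h a' s' b' t') = h a s b t"
proof -
  have const: "h a' s' b' t' = h a s b t" if "(a', s') \<in> fr a s" "(b', t') \<in> fr b t" for a' s' b' t'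
    by (rule assms(5)) (use that assms(1-4) mem_fraction_iff in metis)+
  have mem: "(a, s) \<in> fr a s" "(b, t) \<in> fr b t"
    using assms(1-4) by (simp_all add: mem_fraction_iff)
  have "(\<Union>(b', t') \<in> fr b t. h a' s' b' t') = h a s b t" if "(a', s') \<in> fr a s" for a' s'
    using const[OF that] mem by blast
  then show ?thesis using mem by blast
qed

lemma mult_fraction:
  assumes carr: "a \<in> carrier A" "s \<in> S" "b \<in> carrier A" "t \<in> S"
  shows "fr a s \<otimes>\<^bsub>L\<^esub> fr b t = fr (a \<otimes> b) (s \<otimes> t)"
proof -
  have "(\<Union>(a', s') \<in> fr a s. \<Union>(b', t') \<in> fr b t. fr (a' \<otimes> b') (s' \<otimes> t')) = fr (a \<otimes> b) (s \<otimes> t)"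
  proof (rule UN_fractions_const[OF carr])
    fix a' s' b' t'
    assume carr': "a' \<in> carrier A" "s' \<in> S" "b' \<in> carrier A" "t' \<in> S"
      and "fr a' s' = fr a s" "fr b' t' = fr b t"
    then obtain w w' where w: "w \<in> S" "w \<otimes> (a' \<otimes> s) = w \<otimes> (a \<otimes> s')"
      and w': "w' \<in> S" "w' \<otimes> (b' \<otimes> t) = w' \<otimes> (b \<otimes> t')"
      using carr carr' by (auto simp: fraction_eq_iff)
    note [simp] = carr carr' w(1) w'(1) S_closed mult_S
    have "(w \<otimes> w') \<otimes> ((a' \<otimes> b') \<otimes> (s \<otimes> t)) = (w \<otimes> (a' \<otimes> s)) \<otimes> (w' \<otimes> (b' \<otimes> t))"
      by (simp add: m_ac)
    also have "\<dots> = (w \<otimes> w') \<otimes> ((a \<otimes> b) \<otimes> (s' \<otimes> t'))"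
      unfolding w(2) w'(2) by (simp add: m_ac)
    finally show "fr (a' \<otimes> b') (s' \<otimes> t') = fr (a \<otimes> b) (s \<otimes> t)"
      by (subst fraction_eq_iff) (auto intro!: bexI[of _ "w \<otimes> w'"])
  qed
  then show ?thesis by (simp add: localization_def)
qed

lemma add_fraction:
  assumes carr: "a \<in> carrier A" "s \<in> S" "b \<in> carrier A" "t \<in> S"
  shows "fr a s \<oplus>\<^bsub>L\<^esub> fr b t = fr (a \<otimes> t \<oplus> b \<otimes> s) (s \<otimes> t)"
proof -
  have "(\<Union>(a', s') \<in> fr a s. \<Union>(b', t') \<in> fr b t. fr (a' \<otimes> t' \<oplus> b' \<otimes> s') (s' \<otimes> t'))
      = fr (a \<otimes> t \<oplus> b \<otimes> s) (s \<otimes> t)"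
  proof (rule UN_fractions_const[OF carr])
    fix a' s' b' t'
    assume carr': "a' \<in> carrier A" "s' \<in> S" "b' \<in> carrier A" "t' \<in> S"
      and "fr a' s' = fr a s" "fr b' t' = fr b t"
    then obtain w w' where w: "w \<in> S" "w \<otimes> (a' \<otimes> s) = w \<otimes> (a \<otimes> s')"
      and w': "w' \<in> S" "w' \<otimes> (b' \<otimes> t) = w' \<otimes> (b \<otimes> t')"
      using carr carr' by (auto simp: fraction_eq_iff)
    note [simp] = carr carr' w(1) w'(1) S_closed mult_S
    have "(w \<otimes> w') \<otimes> ((a' \<otimes> t' \<oplus> b' \<otimes> s') \<otimes> (s \<otimes> t))
        = (w \<otimes> (a' \<otimes> s)) \<otimes> (w' \<otimes> (t' \<otimes> t)) \<oplus> (w' \<otimes> (b' \<otimes> t)) \<otimes> (w \<otimes> (s' \<otimes> s))"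
      by (simp add: m_ac l_distr r_distr)
    also have "\<dots> = (w \<otimes> w') \<otimes> ((a \<otimes> t \<oplus> b \<otimes> s) \<otimes> (s' \<otimes> t'))"
      unfolding w(2) w'(2) by (simp add: m_ac l_distr r_distr)
    finally show "fr (a' \<otimes> t' \<oplus> b' \<otimes> s') (s' \<otimes> t') = fr (a \<otimes> t \<oplus> b \<otimes> s) (s \<otimes> t)"
      by (subst fraction_eq_iff) (auto intro!: bexI[of _ "w \<otimes> w'"])
  qed
  then show ?thesis by (simp add: localization_def)
qed

lemma one_localization: "\<one>\<^bsub>L\<^esub> = fr \<one> \<one>" and zero_localization: "\<zero>\<^bsub>L\<^esub> = fr \<zero> \<one>"
  by (simp_all add: localization_def)

lemmas fraction_simps = one_localization zero_localization mult_fraction add_fraction fraction_closed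

lemma cring_localization: "cring L"
proof -
  note [simp] = fraction_simps S_closed mult_S one_S
  have carrE: thesis if "x \<in> carrier L" "\<And>a s. x = fr a s \<Longrightarrow> a \<in> carrier A \<Longrightarrow> s \<in> S \<Longrightarrow> thesis" for x thesis
    using that by (auto simp: carrier_localization)
  show ?thesis
  proof (rule cringI)
    show "abelian_group L"
    proof (rule abelian_groupI)
      fix x y z assume "x \<in> carrier L" "y \<in> carrier L" "z \<in> carrier L"
      then show "x \<oplus>\<^bsub>L\<^esub> y \<oplus>\<^bsub>L\<^esub> z = x \<oplus>\<^bsub>L\<^esub> (y \<oplus>\<^bsub>L\<^esub> z)"
        by (elim carrE) (simp, rule fraction_eqI, simp_all add: l_distr r_distr m_ac a_ac)
    next
      fix x y assume "x \<in> carrier L" "y \<in> carrier L"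
      then show "x \<oplus>\<^bsub>L\<^esub> y = y \<oplus>\<^bsub>L\<^esub> x"
        by (elim carrE) (simp, rule fraction_eqI, simp_all add: l_distr r_distr m_ac a_ac)
    next
      fix x assume "x \<in> carrier L"
      then obtain a s where x: "x = fr a s" "a \<in> carrier A" "s \<in> S" by (elim carrE)
      then have "fr (\<ominus> a) s \<oplus>\<^bsub>L\<^esub> x = \<zero>\<^bsub>L\<^esub>"
        by (simp, intro fraction_eqI) (simp_all add: l_minus l_neg)
      moreover have "fr (\<ominus> a) s \<in> carrier L" using x by simp
      ultimately show "\<exists>y \<in> carrier L. y \<oplus>\<^bsub>L\<^esub> x = \<zero>\<^bsub>L\<^esub>" by (rule bexI)
    next
      fix x y assume "x \<in> carrier L" "y \<in> carrier L"
      then show "x \<oplus>\<^bsub>L\<^esub> y \<in> carrier L" by (elim carrE) simp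
    next
      fix x assume "x \<in> carrier L"
      then show "\<zero>\<^bsub>L\<^esub> \<oplus>\<^bsub>L\<^esub> x = x" by (elim carrE) simp
    qed simp
    show "comm_monoid L"
    proof (rule comm_monoidI)
      fix x y z assume "x \<in> carrier L" "y \<in> carrier L" "z \<in> carrier L"
      then show "x \<otimes>\<^bsub>L\<^esub> y \<otimes>\<^bsub>L\<^esub> z = x \<otimes>\<^bsub>L\<^esub> (y \<otimes>\<^bsub>L\<^esub> z)"
        by (elim carrE) (simp, rule fraction_eqI, simp_all add: m_ac)
    next
      fix x y assume "x \<in> carrier L" "y \<in> carrier L"
      then show "x \<otimes>\<^bsub>L\<^esub> y = y \<otimes>\<^bsub>L\<^esub> x"
        by (elim carrE) (simp, rule fraction_eqI, simp_all add: m_ac)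
    next
      fix x y assume "x \<in> carrier L" "y \<in> carrier L"
      then show "x \<otimes>\<^bsub>L\<^esub> y \<in> carrier L" by (elim carrE) simp
    next
      fix x assume "x \<in> carrier L"
      then show "\<one>\<^bsub>L\<^esub> \<otimes>\<^bsub>L\<^esub> x = x" by (elim carrE) simp
    qed simp
    fix x y z assume "x \<in> carrier L" "y \<in> carrier L" "z \<in> carrier L"
    then show "(x \<oplus>\<^bsub>L\<^esub> y) \<otimes>\<^bsub>L\<^esub> z = x \<otimes>\<^bsub>L\<^esub> z \<oplus>\<^bsub>L\<^esub> y \<otimes>\<^bsub>L\<^esub> z"
      by (elim carrE) (simp, rule fraction_eqI, simp_all add: l_distr r_distr m_ac a_ac)
  qed
qed

end

section \<open>Polynomial rings and substitution\<close>

lemma mem_poly_ring: "p \<in> carrier (poly_ring k) \<longleftrightarrow> (\<forall>m \<in> Poly_Mapping.keys p. Poly_Mapping.keys m \<subseteq> {1..k})"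
  by (simp add: poly_ring_def)

lemma poly_ring_simps [simp]:
  "x \<otimes>\<^bsub>poly_ring k\<^esub> y = x * y" "x \<oplus>\<^bsub>poly_ring k\<^esub> y = x + y"
  "\<one>\<^bsub>poly_ring k\<^esub> = 1" "\<zero>\<^bsub>poly_ring k\<^esub> = 0"
  by (simp_all add: poly_ring_def)

lemma keys_pm_add_nat: "Poly_Mapping.keys (m + m' :: nat \<Rightarrow>\<^sub>0 nat) = Poly_Mapping.keys m \<union> Poly_Mapping.keys m'"
  by (auto simp: in_keys_iff lookup_add)

context
  fixes k :: nat
begin

lemma zero_in_poly_ring [simp, intro]: "0 \<in> carrier (poly_ring k)"
  and Const_in_poly_ring [simp, intro]: "Const c \<in> carrier (poly_ring k)"
  and one_in_poly_ring [simp, intro]: "1 \<in> carrier (poly_ring k)"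
  and Var_in_poly_ring [intro]: "1 \<le> i \<Longrightarrow> i \<le> k \<Longrightarrow> Var i \<in> carrier (poly_ring k)"
  by (auto simp: mem_poly_ring Const_def Var_def)

lemma add_in_poly_ring [intro]:
    "p \<in> carrier (poly_ring k) \<Longrightarrow> q \<in> carrier (poly_ring k) \<Longrightarrow> p + q \<in> carrier (poly_ring k)"
  using keys_add[of p q] by (auto simp: mem_poly_ring)

lemma mult_in_poly_ring [intro]:
    "p \<in> carrier (poly_ring k) \<Longrightarrow> q \<in> carrier (poly_ring k) \<Longrightarrow> p * q \<in> carrier (poly_ring k)"
  using keys_mult[of p q] by (force simp: mem_poly_ring keys_pm_add_nat)

lemma uminus_in_poly_ring [intro]: "p \<in> carrier (poly_ring k) \<Longrightarrow> - p \<in> carrier (poly_ring k)"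
  by (auto simp: mem_poly_ring in_keys_iff)

lemma diff_in_poly_ring [intro]:
    "p \<in> carrier (poly_ring k) \<Longrightarrow> q \<in> carrier (poly_ring k) \<Longrightarrow> p - q \<in> carrier (poly_ring k)"
  using add_in_poly_ring[of p "- q"] uminus_in_poly_ring[of q] by simp

lemma power_in_poly_ring [intro]: "p \<in> carrier (poly_ring k) \<Longrightarrow> p ^ i \<in> carrier (poly_ring k)"
  by (induction i) auto

lemma sum_in_poly_ring:
    "(\<And>x. x \<in> I \<Longrightarrow> f x \<in> carrier (poly_ring k)) \<Longrightarrow> (\<Sum>x\<in>I. f x) \<in> carrier (poly_ring k)"
  by (induction I rule: infinite_finite_induct) auto

lemma prod_in_poly_ring:
    "(\<And>x. x \<in> I \<Longrightarrow> f x \<in> carrier (poly_ring k)) \<Longrightarrow> (\<Prod>x\<in>I. f x) \<in> carrier (poly_ring k)"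
  by (induction I rule: infinite_finite_induct) auto

end

text \<open>Covers the polynomial rings and the ring of invariants at once: both are subsets of
  \<open>cpoly\<close> with the operations of that type.\<close>

lemma cring_of_type_operations:
  fixes B :: "'a::comm_ring_1 ring"
  assumes [simp]: "mult B = (*)" "add B = (+)" "one B = 1" "zero B = 0"
    and [intro]: "1 \<in> carrier B" "\<And>x y. x \<in> carrier B \<Longrightarrow> y \<in> carrier B \<Longrightarrow> x + y \<in> carrier B"
      "\<And>x y. x \<in> carrier B \<Longrightarrow> y \<in> carrier B \<Longrightarrow> x * y \<in> carrier B" "\<And>x. x \<in> carrier B \<Longrightarrow> - x \<in> carrier B"
  shows "cring B"
proof -
  have [intro]: "0 \<in> carrier B" using assms(5,6,8) by (metis add.right_inverse)
  show ?thesis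
  proof (rule cringI)
    show "abelian_group B"
    proof (rule abelian_groupI)
      fix x assume "x \<in> carrier B"
      then show "\<exists>y \<in> carrier B. y \<oplus>\<^bsub>B\<^esub> x = \<zero>\<^bsub>B\<^esub>"
        by (intro bexI[of _ "- x"]) auto
    qed (auto simp: algebra_simps)
    show "comm_monoid B"
      by (rule comm_monoidI) (auto simp: algebra_simps)
  qed (auto simp: algebra_simps)
qed

lemma cring_poly_ring: "cring (poly_ring k)"
proof (rule cring_of_type_operations)
  show "mult (poly_ring k) = (*)" "add (poly_ring k) = (+)" by (simp_all add: poly_ring_def)
qed auto

lemma a_inv_poly_ring: "p \<in> carrier (poly_ring k) \<Longrightarrow> \<ominus>\<^bsub>poly_ring k\<^esub> p = - p"
proof -
  assume p: "p \<in> carrier (poly_ring k)"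
  interpret cring "poly_ring k" by (rule cring_poly_ring)
  show ?thesis by (rule minus_equality) (use p in auto)
qed

lemma ideal_poly_ringI:
  assumes "I \<subseteq> carrier (poly_ring k)" "0 \<in> I" "\<And>p q. p \<in> I \<Longrightarrow> q \<in> I \<Longrightarrow> p + q \<in> I"
    and mult: "\<And>p q. p \<in> I \<Longrightarrow> q \<in> carrier (poly_ring k) \<Longrightarrow> q * p \<in> I"
  shows "ideal I (poly_ring k)"
proof -
  interpret cring "poly_ring k" by (rule cring_poly_ring)
  show ?thesis
  proof (rule idealI)
    show "subgroup I (add_monoid (poly_ring k))"
    proof (rule add.subgroupI)
      fix p assume "p \<in> I"
      then have "(- 1) * p \<in> I" by (intro mult uminus_in_poly_ring) auto
      then show "\<ominus>\<^bsub>poly_ring k\<^esub> p \<in> I" using \<open>p \<in> I\<close> assms(1) by (auto simp: a_inv_poly_ring)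
    qed (use assms in auto)
    fix p q assume "p \<in> I" "q \<in> carrier (poly_ring k)"
    then show "q \<otimes>\<^bsub>poly_ring k\<^esub> p \<in> I" "p \<otimes>\<^bsub>poly_ring k\<^esub> q \<in> I"
      using mult by (auto simp: mult.commute[of p])
  qed (rule ring_axioms)
qed

lemma poly_ring_coset_eq_iff:
  assumes "ideal I (poly_ring k)" "p \<in> carrier (poly_ring k)" "q \<in> carrier (poly_ring k)"
  shows "I +>\<^bsub>poly_ring k\<^esub> p = I +>\<^bsub>poly_ring k\<^esub> q \<longleftrightarrow> p - q \<in> I"
proof -
  interpret cring "poly_ring k" by (rule cring_poly_ring)
  show ?thesis
    using quotient_eq_iff_same_a_r_cos[OF assms] assms by (simp add: minus_eq a_inv_poly_ring)
qed

section \<open>Evaluation and substitution homomorphisms\<close>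

definition mon_eval :: "(nat \<Rightarrow> 'b::comm_ring_1) \<Rightarrow> (nat \<Rightarrow>\<^sub>0 nat) \<Rightarrow> 'b" where
  "mon_eval h m = (\<Prod>i \<in> Poly_Mapping.keys m. h i ^ Poly_Mapping.lookup m i)"

lemma mon_eval_superset:
  assumes "finite I" "Poly_Mapping.keys m \<subseteq> I"
  shows "mon_eval h m = (\<Prod>i \<in> I. h i ^ Poly_Mapping.lookup m i)"
  unfolding mon_eval_def using assms by (intro prod.mono_neutral_left) (auto simp: in_keys_iff)

lemma mon_eval_add: "mon_eval h (m + m') = mon_eval h m * mon_eval h m'"
proof -
  let ?I = "Poly_Mapping.keys m \<union> Poly_Mapping.keys m'"
  show ?thesis
    by (subst (1 2 3) mon_eval_superset[of ?I])
      (auto simp: keys_pm_add_nat lookup_add power_add prod.distrib)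
qed

text \<open>Instantiated three times: evaluation at a point, substitution of polynomials, and
  passage to iterated univariate polynomials.\<close>

locale coeff_hom =
  fixes \<iota> :: "complex \<Rightarrow> 'b::comm_ring_1"
  assumes hom_0: "\<iota> 0 = 0" and hom_1: "\<iota> 1 = 1"
    and hom_add: "\<iota> (c + d) = \<iota> c + \<iota> d" and hom_mult: "\<iota> (c * d) = \<iota> c * \<iota> d"
begin

lemma eval_hom_superset:
  assumes "finite K" "Poly_Mapping.keys p \<subseteq> K"
  shows "eval_hom \<iota> h p = (\<Sum>m \<in> K. \<iota> (Poly_Mapping.lookup p m) * mon_eval h m)"
  unfolding eval_hom_def mon_eval_def[symmetric]
  using assms by (intro sum.mono_neutral_left) (auto simp: in_keys_iff hom_0)

lemma eval_hom_add: "eval_hom \<iota> h (p + q) = eval_hom \<iota> h p + eval_hom \<iota> h q"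
proof -
  let ?K = "Poly_Mapping.keys p \<union> Poly_Mapping.keys q"
  show ?thesis
    by (subst (1 2 3) eval_hom_superset[of ?K])
      (use keys_add[of p q] in \<open>auto simp: lookup_add hom_add algebra_simps sum.distrib\<close>)
qed

lemma eval_hom_0 [simp]: "eval_hom \<iota> h 0 = 0"
  by (simp add: eval_hom_def)

lemma eval_hom_single: "eval_hom \<iota> h (Poly_Mapping.single m c) = \<iota> c * mon_eval h m"
  by (cases "c = 0") (auto simp: eval_hom_def mon_eval_def hom_0)

lemma eval_hom_Const [simp]: "eval_hom \<iota> h (Const c) = \<iota> c"
  by (simp add: Const_def eval_hom_single mon_eval_def)

lemma eval_hom_Var [simp]: "eval_hom \<iota> h (Var i) = h i"
  by (simp add: Var_def eval_hom_single mon_eval_def hom_1)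

lemma eval_hom_1 [simp]: "eval_hom \<iota> h 1 = 1"
  using eval_hom_Const[of h 1] by (simp add: Const_def hom_1 flip: single_one)

lemma eval_hom_sum: "eval_hom \<iota> h (\<Sum>x\<in>I. f x) = (\<Sum>x\<in>I. eval_hom \<iota> h (f x))"
  by (induction I rule: infinite_finite_induct) (auto simp: eval_hom_add)

end

lemma cpoly_sum_monomials:
  "p = (\<Sum>m \<in> Poly_Mapping.keys p. Poly_Mapping.single m (Poly_Mapping.lookup p m))" for p :: cpoly
  by (rule poly_mapping_eqI) (auto simp: lookup_sum lookup_single when_def in_keys_iff sum.delta')

context coeff_hom
begin

lemma eval_hom_mult: "eval_hom \<iota> h (p * q) = eval_hom \<iota> h p * eval_hom \<iota> h q"
proof -
  have "eval_hom \<iota> h (p * q) = (\<Sum>m \<in> Poly_Mapping.keys p. \<Sum>m' \<in> Poly_Mapping.keys q.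
      \<iota> (Poly_Mapping.lookup p m * Poly_Mapping.lookup q m') * mon_eval h (m + m'))"
    by (subst cpoly_sum_monomials[of p], subst cpoly_sum_monomials[of q])
      (simp add: sum_product eval_hom_sum mult_single eval_hom_single)
  also have "\<dots> = eval_hom \<iota> h p * eval_hom \<iota> h q"
    by (simp add: eval_hom_def mon_eval_add hom_mult sum_product algebra_simps flip: mon_eval_def)
  finally show ?thesis .
qed

lemma eval_hom_uminus: "eval_hom \<iota> h (- p) = - eval_hom \<iota> h p"
  using eval_hom_add[of h p "- p"] by (simp add: eq_neg_iff_add_eq_0 add.commute)

lemma eval_hom_diff: "eval_hom \<iota> h (p - q) = eval_hom \<iota> h p - eval_hom \<iota> h q"
  using eval_hom_add[of h p "- q"] by (simp add: eval_hom_uminus)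

lemma eval_hom_power: "eval_hom \<iota> h (p ^ i) = eval_hom \<iota> h p ^ i"
  by (induction i) (auto simp: eval_hom_mult)

lemma eval_hom_prod: "eval_hom \<iota> h (\<Prod>x\<in>I. f x) = (\<Prod>x\<in>I. eval_hom \<iota> h (f x))"
  by (induction I rule: infinite_finite_induct) (auto simp: eval_hom_mult)

lemmas eval_hom_simps = eval_hom_add eval_hom_mult eval_hom_uminus eval_hom_diff eval_hom_power
  eval_hom_sum eval_hom_prod

lemma eval_hom_subst: "eval_hom \<iota> g (subst_poly h p) = eval_hom \<iota> (\<lambda>i. eval_hom \<iota> g (h i)) p"
  by (subst (2) eval_hom_def) (simp add: eval_hom_simps, simp add: eval_hom_def)

end

lemma eval_hom_cong:
  assumes "p \<in> carrier (poly_ring k)" "\<And>i. 1 \<le> i \<Longrightarrow> i \<le> k \<Longrightarrow> h i = h' i"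
  shows "eval_hom \<iota> h p = eval_hom \<iota> h' p"
  unfolding eval_hom_def
proof (intro sum.cong prod.cong refl arg_cong2[of _ _ _ _ "(*)"] arg_cong2[of _ _ _ _ "(^)"])
  fix m i assume "m \<in> Poly_Mapping.keys p" "i \<in> Poly_Mapping.keys m"
  then have "i \<in> {1..k}" using assms(1) unfolding mem_poly_ring by blast
  then show "h i = h' i" using assms(2) by simp
qed

interpretation eval_at: coeff_hom "\<lambda>c. c"
  by unfold_locales auto

lemma coeff_hom_Const: "coeff_hom Const"
  by unfold_locales (auto simp: Const_def single_add mult_single)

interpretation subst: coeff_hom Const
  by (rule coeff_hom_Const)

lemma subst_in_poly_ring:
  assumes "p \<in> carrier (poly_ring k)" "\<And>i. 1 \<le> i \<Longrightarrow> i \<le> k \<Longrightarrow> h i \<in> carrier (poly_ring l)"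
  shows "subst_poly h p \<in> carrier (poly_ring l)"
  unfolding eval_hom_def
proof (intro sum_in_poly_ring mult_in_poly_ring prod_in_poly_ring power_in_poly_ring Const_in_poly_ring)
  fix m i assume "m \<in> Poly_Mapping.keys p" "i \<in> Poly_Mapping.keys m"
  then have "i \<in> {1..k}" using assms(1) unfolding mem_poly_ring by blast
  then show "h i \<in> carrier (poly_ring l)" using assms(2) by simp
qed

text \<open>The outer variable of \<open>complex poly poly\<close> is $u$, the inner one is $v$.\<close>

definition bipoly :: "cpoly \<Rightarrow> complex poly poly" where
  "bipoly = eval_hom (\<lambda>c. [:[:c:]:]) (\<lambda>i. if i = 1 then [:0, 1:] else [:[:0, 1:]:])"

interpretation bipoly: coeff_hom "\<lambda>c. [:[:c:]:] :: complex poly poly"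
  by unfold_locales (auto simp: one_pCons)

lemma bipoly_simps:
  "bipoly 0 = 0" "bipoly 1 = 1" "bipoly (Const c) = [:[:c:]:]"
  "bipoly (Var 1) = [:0, 1:]" "bipoly (Var 2) = [:[:0, 1:]:]"
  "bipoly (p + q) = bipoly p + bipoly q" "bipoly (p * q) = bipoly p * bipoly q"
  "bipoly (p - q) = bipoly p - bipoly q" "bipoly (- p) = - bipoly p" "bipoly (p ^ i) = bipoly p ^ i"
  "bipoly (sum f I) = (\<Sum>x\<in>I. bipoly (f x))" "bipoly (Var (Suc 0)) = [:0, 1:]"
  by (simp_all add: bipoly_def bipoly.eval_hom_simps)

lemma bipoly_single:
  assumes "Poly_Mapping.keys m \<subseteq> {1..2}"
  shows "bipoly (Poly_Mapping.single m c) = monom (monom c (Poly_Mapping.lookup m 2)) (Poly_Mapping.lookup m 1)"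
proof -
  have "{1..2::nat} = {1, 2}" by auto
  then show ?thesis
    by (simp add: bipoly_def bipoly.eval_hom_single mon_eval_superset[OF _ assms] monom_altdef
        poly_const_pow mult.commute)
qed

text \<open>A monomial in u and v is determined by its two exponents, so exactly one summand
  contributes to this coefficient. Hence \<open>bipoly\<close> is injective on C[u,v].\<close>

lemma bipoly_coeff:
  assumes "p \<in> carrier (poly_ring 2)" "m \<in> Poly_Mapping.keys p"
  shows "coeff (coeff (bipoly p) (Poly_Mapping.lookup m 1)) (Poly_Mapping.lookup m 2) = Poly_Mapping.lookup p m"
proof -
  have eq: "m' = m \<longleftrightarrow> Poly_Mapping.lookup m' 1 = Poly_Mapping.lookup m 1 \<and> Poly_Mapping.lookup m' 2 = Poly_Mapping.lookup m 2"
    if "m' \<in> Poly_Mapping.keys p" for m'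
  proof
    assume *: "Poly_Mapping.lookup m' 1 = Poly_Mapping.lookup m 1 \<and> Poly_Mapping.lookup m' 2 = Poly_Mapping.lookup m 2"
    show "m' = m"
    proof (rule poly_mapping_eqI)
      fix i
      have "Poly_Mapping.keys m \<subseteq> {1..2}" "Poly_Mapping.keys m' \<subseteq> {1..2}"
        using assms that by (auto simp: mem_poly_ring)
      then have "Poly_Mapping.lookup m i = 0 \<and> Poly_Mapping.lookup m' i = 0" if "i \<noteq> 1" "i \<noteq> 2"
        using that by (auto simp: in_keys_iff subset_iff)
      then show "Poly_Mapping.lookup m' i = Poly_Mapping.lookup m i" using * by metis
    qed
  qed auto
  have "bipoly p = (\<Sum>m' \<in> Poly_Mapping.keys p. bipoly (Poly_Mapping.single m' (Poly_Mapping.lookup p m')))"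
    by (subst (1) cpoly_sum_monomials[of p]) (simp only: bipoly_simps)
  also have "\<dots> = (\<Sum>m' \<in> Poly_Mapping.keys p. monom (monom (Poly_Mapping.lookup p m') (Poly_Mapping.lookup m' 2)) (Poly_Mapping.lookup m' 1))"
    using assms(1) by (intro sum.cong bipoly_single) (auto simp: mem_poly_ring)
  finally have "coeff (coeff (bipoly p) (Poly_Mapping.lookup m 1)) (Poly_Mapping.lookup m 2)
      = (\<Sum>m' \<in> Poly_Mapping.keys p. if m' = m then Poly_Mapping.lookup p m' else 0)"
    by (auto simp: coeff_sum eq intro!: sum.cong)
  then show ?thesis using assms by simp
qed

lemma bipoly_eq_0_iff:
  assumes "p \<in> carrier (poly_ring 2)"
  shows "bipoly p = 0 \<longleftrightarrow> p = 0"
proof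
  assume "bipoly p = 0"
  then have "Poly_Mapping.lookup p m = 0" for m
    using bipoly_coeff[OF assms, of m] by (auto simp: in_keys_iff)
  then show "p = 0" by (auto intro: poly_mapping_eqI)
qed (simp add: bipoly_def)

lemma eval_at_eq_bipoly:
  "eval_at (\<lambda>i. if i = 1 then s else t) p = poly (poly (bipoly p) [:s:]) t"
  by (auto simp: bipoly_def eval_hom_def poly_sum poly_prod intro!: sum.cong prod.cong)

text \<open>As a polynomial in u over the domain C[v], a nonzero p has finitely many roots. But
  every constant s is a root, because p(s, v) vanishes for all v and so is the zero polynomial in
  v.\<close>

lemma poly_eq_0_if_vanishing:
  assumes p: "p \<in> carrier (poly_ring 2)" and "\<And>w. eval_at w p = 0"
  shows "p = 0"
proof (rule ccontr)
  assume "p \<noteq> 0"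
  then have "finite {x. poly (bipoly p) x = 0}"
    using p by (simp add: bipoly_eq_0_iff poly_roots_finite)
  moreover have "poly (poly (bipoly p) [:s:]) t = 0" for s t
    using assms(2) by (metis eval_at_eq_bipoly)
  then have "poly (bipoly p) [:s:] = 0" for s
    using poly_all_0_iff_0 by blast
  then have "range (\<lambda>s. [:s:]) \<subseteq> {x. poly (bipoly p) x = 0}" by auto
  ultimately have "finite (range (\<lambda>s::complex. [:s:]))" by (rule rev_finite_subset)
  moreover have "inj (\<lambda>s::complex. [:s:])" by (auto intro: injI)
  ultimately show False using finite_imageD infinite_UNIV_char_0 by blast
qed

section \<open>The local ring and the fraction field of a parametrized hypersurface\<close>

context ideal
begin

lemma carrier_Quot: "carrier (R Quot I) = (+>) I ` carrier R"
  by (auto simp: FactRing_def A_RCOSETS_def')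

lemma Quot_mult: "a \<in> carrier R \<Longrightarrow> b \<in> carrier R \<Longrightarrow> (I +> a) \<otimes>\<^bsub>R Quot I\<^esub> (I +> b) = I +> (a \<otimes> b)"
  and Quot_add: "a \<in> carrier R \<Longrightarrow> b \<in> carrier R \<Longrightarrow> (I +> a) \<oplus>\<^bsub>R Quot I\<^esub> (I +> b) = I +> (a \<oplus> b)"
  and Quot_one: "\<one>\<^bsub>R Quot I\<^esub> = I +> \<one>"
  using rcos_ring_hom by (simp_all add: ring_hom_def)

lemma Quot_zero: "\<zero>\<^bsub>R Quot I\<^esub> = I +> \<zero>"
  using a_rcos_zero[OF ideal_axioms additive_subgroup.zero_closed[OF is_additive_subgroup]]
  by (simp add: FactRing_def)

end

text \<open>What the algebra needs from the surface: a substitution whose kernel is generated by F,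
  with the origin on F = 0.\<close>

locale hypersurface_parametrization =
  fixes F :: cpoly and h :: "nat \<Rightarrow> cpoly"
  assumes F_in: "F \<in> carrier (poly_ring 3)" and F_origin: "eval_at (origin 3) F = 0"
    and ker: "\<And>p. p \<in> carrier (poly_ring 3) \<Longrightarrow> subst_poly h p = 0 \<longleftrightarrow> (\<exists>g \<in> carrier (poly_ring 3). p = g * F)"
begin

abbreviation "P3 \<equiv> poly_ring 3"
abbreviation "S3 \<equiv> nonvanishing_at 3 (origin 3)"
abbreviation "\<phi> \<equiv> subst_poly h"

lemma mem_S3: "s \<in> S3 \<longleftrightarrow> s \<in> carrier P3 \<and> eval_at (origin 3) s \<noteq> 0"
  by (simp add: nonvanishing_at_def)

sublocale L0: mult_closed_set P3 S3
  rewrites "\<And>x y. x \<otimes>\<^bsub>P3\<^esub> y = x * y" and "\<And>x y. x \<oplus>\<^bsub>P3\<^esub> y = x + y"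
    and "\<one>\<^bsub>P3\<^esub> = 1" and "\<zero>\<^bsub>P3\<^esub> = 0"
proof -
  interpret cring P3 by (rule cring_poly_ring)
  show "mult_closed_set P3 S3"
    by unfold_locales (auto simp: mem_S3 eval_at.eval_hom_simps)
qed simp_all

text \<open>If \<phi>(s) = 0, then F divides s, so s vanishes at the origin together with F.\<close>

lemma \<phi>_S3_nonzero: "s \<in> S3 \<Longrightarrow> \<phi> s \<noteq> 0"
  using ker[of s] F_origin by (auto simp: mem_S3 eval_at.eval_hom_simps)

abbreviation "J \<equiv> PIdl\<^bsub>L0.L\<^esub> (L0.fr F 1)"

lemma one_S3 [simp]: "1 \<in> S3"
  by (simp add: mem_S3)

lemma S3_poly: "s \<in> S3 \<Longrightarrow> s \<in> carrier P3"
  by (simp add: mem_S3)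

lemma S3_mult: "s \<in> S3 \<Longrightarrow> t \<in> S3 \<Longrightarrow> s * t \<in> S3"
  by (auto simp: mem_S3 eval_at.eval_hom_simps)

lemma F_over_1: "L0.fr F 1 \<in> carrier L0.L"
  using F_in by (intro L0.fraction_closed) auto

lemma ideal_J: "ideal J L0.L"
  using cring.cgenideal_ideal[OF L0.cring_localization F_over_1] .

text \<open>Denominators and the witnesses of equality of fractions have nonzero image under \<phi>,
  so they cancel in the domain C[u,v] and membership only depends on the numerator.\<close>

lemma fraction_in_J_iff:
  assumes "p \<in> carrier P3" "s \<in> S3"
  shows "L0.fr p s \<in> J \<longleftrightarrow> \<phi> p = 0"
proof
  assume "L0.fr p s \<in> J"
  then obtain g t where g: "g \<in> carrier P3" "t \<in> S3" "L0.fr p s = L0.fr g t \<otimes>\<^bsub>L0.L\<^esub> L0.fr F 1"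
    by (auto simp: cgenideal_def L0.carrier_localization)
  then have "L0.fr p s = L0.fr (g * F) t"
    using F_in by (simp add: L0.mult_fraction)
  then obtain w where w: "w \<in> S3" "w * (p * t) = w * (g * F * s)"
    using L0.fraction_eq_iff[of p "g * F" s t] g assms F_in by auto
  then have "w * p * t = (w * g * s) * F" by (simp add: algebra_simps)
  moreover have "w * g * s \<in> carrier P3" "w * p * t \<in> carrier P3" using w g assms S3_poly by auto
  ultimately have "\<phi> (w * p * t) = 0" using ker by blast
  then show "\<phi> p = 0" using \<phi>_S3_nonzero w(1) g(2) by (simp add: subst.eval_hom_simps)
next
  assume "\<phi> p = 0"
  then obtain g where g: "g \<in> carrier P3" "p = g * F" using ker assms by auto
  then have "L0.fr p s = L0.fr g s \<otimes>\<^bsub>L0.L\<^esub> L0.fr F 1"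
    using F_in assms by (simp add: L0.mult_fraction)
  then show "L0.fr p s \<in> J" using L0.fraction_closed g assms by (auto simp: cgenideal_def)
qed

definition quot :: "cpoly \<times> cpoly \<Rightarrow> (cpoly \<times> cpoly) set set" where
  "quot = (\<lambda>(p, s). J +>\<^bsub>L0.L\<^esub> L0.fr p s)"

lemma R_bar_eq: "R_bar F = L0.L Quot J"
  by (simp add: R_bar_def poly_ring_at_origin_def poly_at_origin_def)

lemma to_R_bar_eq: "to_R_bar F p = quot (p, 1)"
  by (simp add: to_R_bar_def quot_def poly_ring_at_origin_def poly_at_origin_def)

lemma carrier_R_bar: "carrier (R_bar F) = quot ` (carrier P3 \<times> S3)"
  unfolding R_bar_eq ideal.carrier_Quot[OF ideal_J] L0.carrier_localization quot_def
  by (auto simp: image_iff)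

lemma quot_eq_iff:
  assumes "p \<in> carrier P3" "p' \<in> carrier P3" "s \<in> S3" "s' \<in> S3"
  shows "quot (p, s) = quot (p', s') \<longleftrightarrow> \<phi> p * \<phi> s' = \<phi> p' * \<phi> s"
proof -
  interpret L: cring L0.L by (rule L0.cring_localization)
  note S3_poly [intro]
  \<comment> \<open>The negative in the localization is abstract; it is identified with the fraction
    of the negated numerator so that the difference becomes one explicit fraction.\<close>
  have "L0.fr (- p') s' \<oplus>\<^bsub>L0.L\<^esub> L0.fr p' s' = L0.fr 0 (s' * s')"
    using assms by (subst L0.add_fraction) auto
  also have "\<dots> = \<zero>\<^bsub>L0.L\<^esub>"
    unfolding L0.zero_localization using assms by (intro L0.fraction_eqI S3_mult) auto
  finally have "L0.fr (- p') s' \<oplus>\<^bsub>L0.L\<^esub> L0.fr p' s' = \<zero>\<^bsub>L0.L\<^esub>" .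
  then have "\<ominus>\<^bsub>L0.L\<^esub> L0.fr p' s' = L0.fr (- p') s'"
    by (intro L.minus_equality L0.fraction_closed) (use assms in auto)
  then have "L0.fr p s \<ominus>\<^bsub>L0.L\<^esub> L0.fr p' s' = L0.fr (p * s' - p' * s) (s * s')"
    unfolding L.minus_eq by (simp, subst L0.add_fraction) (use assms in auto)
  then have "quot (p, s) = quot (p', s') \<longleftrightarrow> L0.fr (p * s' - p' * s) (s * s') \<in> J"
    unfolding quot_def using L.quotient_eq_iff_same_a_r_cos[OF ideal_J, of "L0.fr p s" "L0.fr p' s'"] L0.fraction_closed assms
    by simp
  also have "\<dots> \<longleftrightarrow> \<phi> p * \<phi> s' = \<phi> p' * \<phi> s"
    by (subst fraction_in_J_iff) (use assms S3_mult in \<open>auto simp: subst.eval_hom_simps\<close>)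
  finally show ?thesis .
qed

lemma quot_mult:
  assumes "p \<in> carrier P3" "p' \<in> carrier P3" "s \<in> S3" "s' \<in> S3"
  shows "quot (p, s) \<otimes>\<^bsub>R_bar F\<^esub> quot (p', s') = quot (p * p', s * s')"
  unfolding R_bar_eq quot_def
  using assms by (simp add: ideal.Quot_mult[OF ideal_J] L0.fraction_closed L0.mult_fraction)

lemma quot_add:
  assumes "p \<in> carrier P3" "p' \<in> carrier P3" "s \<in> S3" "s' \<in> S3"
  shows "quot (p, s) \<oplus>\<^bsub>R_bar F\<^esub> quot (p', s') = quot (p * s' + p' * s, s * s')"
  unfolding R_bar_eq quot_def
  using assms by (simp add: ideal.Quot_add[OF ideal_J] L0.fraction_closed L0.add_fraction)

lemma quot_one: "\<one>\<^bsub>R_bar F\<^esub> = quot (1, 1)"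
  by (simp add: R_bar_eq quot_def ideal.Quot_one[OF ideal_J] L0.one_localization)

lemma quot_zero: "\<zero>\<^bsub>R_bar F\<^esub> = quot (0, 1)"
  by (simp add: R_bar_eq quot_def ideal.Quot_zero[OF ideal_J] L0.zero_localization)

lemma quot_eq_zero_iff: "p \<in> carrier P3 \<Longrightarrow> s \<in> S3 \<Longrightarrow> quot (p, s) = \<zero>\<^bsub>R_bar F\<^esub> \<longleftrightarrow> \<phi> p = 0"
  using quot_eq_iff[of p 0 s 1] by (simp add: quot_zero)

text \<open>A class vanishes exactly if \<phi> kills its numerator, so the absence of zero divisors
  is inherited from C[u,v].\<close>

lemma domain_R_bar: "domain (R_bar F)"
proof (intro domain.intro domain_axioms.intro)
  show "cring (R_bar F)"
    unfolding R_bar_eq using ideal.quotient_is_cring[OF ideal_J L0.cring_localization] .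
  show "\<one>\<^bsub>R_bar F\<^esub> \<noteq> \<zero>\<^bsub>R_bar F\<^esub>"
    unfolding quot_one by (subst quot_eq_zero_iff) auto
  fix x y
  assume xy: "x \<otimes>\<^bsub>R_bar F\<^esub> y = \<zero>\<^bsub>R_bar F\<^esub>" "x \<in> carrier (R_bar F)" "y \<in> carrier (R_bar F)"
  then obtain p s p' s' where *: "x = quot (p, s)" "y = quot (p', s')"
      "p \<in> carrier P3" "p' \<in> carrier P3" "s \<in> S3" "s' \<in> S3"
    by (auto simp: carrier_R_bar)
  then have "\<phi> (p * p') = 0"
    using xy(1) S3_mult quot_eq_zero_iff[of "p * p'" "s * s'"] by (auto simp: quot_mult)
  then show "x = \<zero>\<^bsub>R_bar F\<^esub> \<or> y = \<zero>\<^bsub>R_bar F\<^esub>"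
    using * by (simp add: quot_eq_zero_iff subst.eval_hom_simps)
qed

theorem local_ring_iso:
  assumes V: "vanishing_ideal 3 V = {p \<in> carrier P3. \<phi> p = 0}"
  shows "\<exists>\<Psi> \<in> ring_iso (R_bar F) (local_ring_at 3 V (origin 3)).
          \<forall>p \<in> carrier P3. \<Psi> (to_R_bar F p) = germ_at 3 V (origin 3) p"
proof -
  let ?I = "vanishing_ideal 3 V"
  let ?Q = "coord_ring 3 V"
  let ?S3 = "coord_fun 3 V ` S3"
  have I: "ideal ?I P3"
    by (rule ideal_poly_ringI) (auto simp: V subst.eval_hom_simps)
  interpret Q: cring ?Q
    unfolding coord_ring_def using ideal.quotient_is_cring[OF I cring_poly_ring] .
  have carrier_Q: "carrier ?Q = coord_fun 3 V ` carrier P3"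
    unfolding coord_ring_def coord_fun_def ideal.carrier_Quot[OF I] ..
  have Q_mult: "coord_fun 3 V p \<otimes>\<^bsub>?Q\<^esub> coord_fun 3 V q = coord_fun 3 V (p * q)"
    and Q_add: "coord_fun 3 V p \<oplus>\<^bsub>?Q\<^esub> coord_fun 3 V q = coord_fun 3 V (p + q)"
    if "p \<in> carrier P3" "q \<in> carrier P3" for p q
    using that by (simp_all add: coord_ring_def coord_fun_def ideal.Quot_mult[OF I] ideal.Quot_add[OF I])
  have Q_one: "\<one>\<^bsub>?Q\<^esub> = coord_fun 3 V 1"
    by (simp add: coord_ring_def coord_fun_def ideal.Quot_one[OF I])
  \<comment> \<open>The vanishing ideal is ker \<phi>, so equality in the coordinate ring is also
    tested by \<phi>.\<close>
  have Q_eq: "coord_fun 3 V p = coord_fun 3 V q \<longleftrightarrow> \<phi> p = \<phi> q"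
    if "p \<in> carrier P3" "q \<in> carrier P3" for p q
    using that unfolding coord_fun_def by (subst poly_ring_coset_eq_iff[OF I]) (auto simp: V subst.eval_hom_simps)
  interpret LQ: mult_closed_set ?Q ?S3
    by unfold_locales (auto simp: carrier_Q Q_one Q_mult S3_poly S3_mult)
  define g where "g = (\<lambda>(p, s). LQ.fr (coord_fun 3 V p) (coord_fun 3 V s))"
  have "\<exists>\<Psi> \<in> ring_iso (R_bar F) LQ.L. \<forall>t \<in> carrier P3 \<times> S3. \<Psi> (quot t) = g t"
  proof (rule ring_iso_by_parametrization[where
        p = "\<lambda>(p, s) (p', s'). (p * s' + p' * s, s * s')" and m = "\<lambda>(p, s) (p', s'). (p * p', s * s')"])
    show "carrier (R_bar F) = quot ` (carrier P3 \<times> S3)" by (rule carrier_R_bar)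
    show "carrier LQ.L = g ` (carrier P3 \<times> S3)"
      by (auto simp: LQ.carrier_localization carrier_Q g_def image_iff)
    show "(1, 1) \<in> carrier P3 \<times> S3" "quot (1, 1) = \<one>\<^bsub>R_bar F\<^esub>" "g (1, 1) = \<one>\<^bsub>LQ.L\<^esub>"
      by (simp_all add: quot_one g_def LQ.one_localization Q_one)
  next
    fix x y assume "x \<in> carrier P3 \<times> S3" "y \<in> carrier P3 \<times> S3"
    then obtain p s p' s' where [simp]: "x = (p, s)" "y = (p', s')"
      and carr: "p \<in> carrier P3" "p' \<in> carrier P3" "s \<in> S3" "s' \<in> S3" by auto
    note carr' = carr carr(3,4)[THEN S3_poly] mult_in_poly_ring add_in_poly_ring S3_poly S3_mult
    \<comment> \<open>The witness w of the localization disappears because \<phi>(w) is nonzero;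
      what remains is the criterion of \<open>quot_eq_iff\<close>.\<close>
    have "g x = g y \<longleftrightarrow> (\<exists>w \<in> S3. \<phi> (w * (p * s')) = \<phi> (w * (p' * s)))"
      using carr' by (simp add: g_def LQ.fraction_eq_iff carrier_Q Q_mult Q_eq)
    also have "\<dots> \<longleftrightarrow> \<phi> p * \<phi> s' = \<phi> p' * \<phi> s"
      using \<phi>_S3_nonzero by (auto simp: subst.eval_hom_simps intro!: exI[of _ 1])
    finally show "quot x = quot y \<longleftrightarrow> g x = g y"
      using carr by (simp add: quot_eq_iff)
    show "(case x of (p, s) \<Rightarrow> \<lambda>(p', s'). (p * s' + p' * s, s * s')) y \<in> carrier P3 \<times> S3
      \<and> quot x \<oplus>\<^bsub>R_bar F\<^esub> quot y = quot ((case x of (p, s) \<Rightarrow> \<lambda>(p', s'). (p * s' + p' * s, s * s')) y)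
      \<and> g x \<oplus>\<^bsub>LQ.L\<^esub> g y = g ((case x of (p, s) \<Rightarrow> \<lambda>(p', s'). (p * s' + p' * s, s * s')) y)"
      using carr' by (simp add: quot_add g_def LQ.add_fraction carrier_Q Q_mult Q_add)
    show "(case x of (p, s) \<Rightarrow> \<lambda>(p', s'). (p * p', s * s')) y \<in> carrier P3 \<times> S3
      \<and> quot x \<otimes>\<^bsub>R_bar F\<^esub> quot y = quot ((case x of (p, s) \<Rightarrow> \<lambda>(p', s'). (p * p', s * s')) y)
      \<and> g x \<otimes>\<^bsub>LQ.L\<^esub> g y = g ((case x of (p, s) \<Rightarrow> \<lambda>(p', s'). (p * p', s * s')) y)"
      using carr' by (simp add: quot_mult g_def LQ.mult_fraction carrier_Q Q_mult)
  qed
  then obtain \<Psi> where \<Psi>: "\<Psi> \<in> ring_iso (R_bar F) LQ.L" "\<And>t. t \<in> carrier P3 \<times> S3 \<Longrightarrow> \<Psi> (quot t) = g t" by blast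
  have "\<Psi> (to_R_bar F p) = germ_at 3 V (origin 3) p" if "p \<in> carrier P3" for p
    using \<Psi>(2)[of "(p, 1)"] that by (simp add: germ_at_def g_def to_R_bar_eq)
  then show ?thesis using \<Psi>(1) unfolding local_ring_at_def by blast
qed

theorem frac_field_iso:
  fixes B :: "cpoly ring"
  assumes B_ops: "mult B = (*)" "add B = (+)" "one B = 1" "zero B = 0" and B: "cring B"
    and \<phi>_B: "\<And>p. p \<in> carrier P3 \<Longrightarrow> \<phi> p \<in> carrier B"
    and birational: "\<And>f. f \<in> carrier B \<Longrightarrow> \<exists>p \<in> carrier P3. \<exists>q \<in> carrier P3. \<phi> q \<noteq> 0 \<and> f * \<phi> q = \<phi> p"
  shows "\<exists>\<Phi> \<in> ring_iso (frac_field (R_bar F)) (frac_field B).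
          \<forall>p \<in> carrier P3. \<Phi> (to_frac_field (R_bar F) (to_R_bar F p)) = to_frac_field B (\<phi> p)"
proof -
  let ?R = "R_bar F"
  interpret R: domain ?R by (rule domain_R_bar)
  interpret B: cring B by (rule B)
  interpret LR: mult_closed_set ?R "carrier ?R - {\<zero>\<^bsub>?R\<^esub>}"
    by unfold_locales (auto simp: R.integral_iff)
  interpret LB: mult_closed_set B "carrier B - {\<zero>\<^bsub>B\<^esub>}"
    using B.one_closed B.m_closed by unfold_locales (auto simp: B_ops)
  \<comment> \<open>Numerators and denominators are polynomials of C[x,y,z] rather than fractions in
    the local ring: (p/s)/(q/t) equals (pt)/(qs).\<close>
  define T where "T = {(p, q). p \<in> carrier P3 \<and> q \<in> carrier P3 \<and> \<phi> q \<noteq> 0}"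
  define f where "f = (\<lambda>(p, q). LR.fr (quot (p, 1)) (quot (q, 1)))"
  define g where "g = (\<lambda>(p, q). LB.fr (\<phi> p) (\<phi> q))"
  have quot_R: "quot (p, s) \<in> carrier ?R" if "p \<in> carrier P3" "s \<in> S3" for p s
    using that by (auto simp: carrier_R_bar)
  have LR_eq: "LR.fr a s = LR.fr b t \<longleftrightarrow> a \<otimes>\<^bsub>?R\<^esub> t = b \<otimes>\<^bsub>?R\<^esub> s"
    if "a \<in> carrier ?R" "b \<in> carrier ?R" "s \<in> carrier ?R - {\<zero>\<^bsub>?R\<^esub>}" "t \<in> carrier ?R - {\<zero>\<^bsub>?R\<^esub>}" for a s b t
    using that by (subst LR.fraction_eq_iff) (auto simp: R.m_lcancel R.one_not_zero intro!: bexI[of _ "\<one>\<^bsub>?R\<^esub>"])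
  have LB_eq: "LB.fr a s = LB.fr b t \<longleftrightarrow> a * t = b * s"
    if "a \<in> carrier B" "b \<in> carrier B" "s \<in> carrier B - {\<zero>\<^bsub>B\<^esub>}" "t \<in> carrier B - {\<zero>\<^bsub>B\<^esub>}" for a s b t
    using that LB.one_S by (subst LB.fraction_eq_iff) (auto simp: B_ops)
  note LB_simps = LB_eq[unfolded B_ops] LB.add_fraction[unfolded B_ops] LB.mult_fraction[unfolded B_ops]
    LB.one_localization[unfolded B_ops]
  have "\<exists>\<Phi> \<in> ring_iso LR.L LB.L. \<forall>t \<in> T. \<Phi> (f t) = g t"
  proof (rule ring_iso_by_parametrization[where
        p = "\<lambda>(p, s) (p', s'). (p * s' + p' * s, s * s')" and m = "\<lambda>(p, s) (p', s'). (p * p', s * s')"])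
    show "carrier LR.L = f ` T"
    proof (intro equalityI subsetI)
      fix x assume "x \<in> carrier LR.L"
      then obtain a b where ab: "x = LR.fr a b" "a \<in> carrier ?R" "b \<in> carrier ?R" "b \<noteq> \<zero>\<^bsub>?R\<^esub>"
        by (auto simp: LR.carrier_localization)
      then obtain p s q t where *: "a = quot (p, s)" "b = quot (q, t)"
          "p \<in> carrier P3" "q \<in> carrier P3" "s \<in> S3" "t \<in> S3"
        by (auto simp: carrier_R_bar)
      have [simp]: "s \<in> carrier P3" "t \<in> carrier P3" using * S3_poly by auto
      have "\<phi> q \<noteq> 0" using ab(4) * by (simp add: quot_eq_zero_iff)
      then have T: "(p * t, q * s) \<in> T"
        using * \<phi>_S3_nonzero by (auto simp: T_def subst.eval_hom_simps)
      have "x = f (p * t, q * s)"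
        unfolding ab f_def prod.case
        using T * ab(4) by (subst LR_eq)
          (auto simp: quot_R mult_in_poly_ring quot_eq_zero_iff quot_mult quot_eq_iff T_def subst.eval_hom_simps)
      then show "x \<in> f ` T" using T by blast
    next
      fix x assume "x \<in> f ` T"
      then show "x \<in> carrier LR.L"
        by (auto simp: f_def T_def quot_R quot_eq_zero_iff intro!: LR.fraction_closed)
    qed
    show "carrier LB.L = g ` T"
    proof (intro equalityI subsetI)
      fix x assume "x \<in> carrier LB.L"
      then obtain a b where ab: "x = LB.fr a b" "a \<in> carrier B" "b \<in> carrier B" "b \<noteq> 0"
        unfolding LB.carrier_localization by (auto simp: B_ops)
      obtain p q where p: "p \<in> carrier P3" "q \<in> carrier P3" "\<phi> q \<noteq> 0" "a * \<phi> q = \<phi> p"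
        using birational[OF ab(2)] by auto
      obtain p' q' where p': "p' \<in> carrier P3" "q' \<in> carrier P3" "\<phi> q' \<noteq> 0" "b * \<phi> q' = \<phi> p'"
        using birational[OF ab(3)] by auto
      have nz: "\<phi> p' \<noteq> 0" using p' ab(4) by (metis mult_eq_0_iff)
      then have T: "(p * q', q * p') \<in> T"
        using p p' by (auto simp: T_def subst.eval_hom_simps)
      \<comment> \<open>With a = \<phi>(p)/\<phi>(q) and b = \<phi>(p')/\<phi>(q'), the quotient a/b
        is \<phi>(p q')/\<phi>(q p').\<close>
      have "a * \<phi> (q * p') = \<phi> (p * q') * b"
        unfolding subst.eval_hom_simps p(4)[symmetric] p'(4)[symmetric] by (simp add: algebra_simps)
      then have "x = g (p * q', q * p')"
        unfolding ab g_def prod.case using T ab p p' nz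
        by (subst LB_eq) (auto simp: \<phi>_B mult_in_poly_ring T_def B_ops)
      then show "x \<in> g ` T" using T by blast
    next
      fix x assume "x \<in> g ` T"
      then obtain p q where "x = g (p, q)" "(p, q) \<in> T" by auto
      then show "x \<in> carrier LB.L"
        using LB.fraction_closed[of "\<phi> p" "\<phi> q"] by (auto simp: g_def T_def \<phi>_B B_ops)
    qed
    show "(1, 1) \<in> T" "f (1, 1) = \<one>\<^bsub>LR.L\<^esub>" "g (1, 1) = \<one>\<^bsub>LB.L\<^esub>"
      by (simp_all add: T_def f_def g_def quot_one LR.one_localization LB_simps B_ops)
  next
    fix x y assume "x \<in> T" "y \<in> T"
    then obtain p s p' s' where [simp]: "x = (p, s)" "y = (p', s')"
      and carr: "p \<in> carrier P3" "p' \<in> carrier P3" "s \<in> carrier P3" "s' \<in> carrier P3" "\<phi> s \<noteq> 0" "\<phi> s' \<noteq> 0"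
      by (auto simp: T_def)
    note simps = carr mult_in_poly_ring add_in_poly_ring quot_R \<phi>_B B_ops quot_eq_zero_iff subst.eval_hom_simps
    show "f x = f y \<longleftrightarrow> g x = g y"
      by (simp add: f_def g_def LR_eq LB_simps quot_mult quot_eq_iff simps)
    show "(case x of (p, s) \<Rightarrow> \<lambda>(p', s'). (p * s' + p' * s, s * s')) y \<in> T
      \<and> f x \<oplus>\<^bsub>LR.L\<^esub> f y = f ((case x of (p, s) \<Rightarrow> \<lambda>(p', s'). (p * s' + p' * s, s * s')) y)
      \<and> g x \<oplus>\<^bsub>LB.L\<^esub> g y = g ((case x of (p, s) \<Rightarrow> \<lambda>(p', s'). (p * s' + p' * s, s * s')) y)"
      by (simp add: T_def f_def g_def LR.add_fraction LB_simps quot_add quot_mult simps)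
    show "(case x of (p, s) \<Rightarrow> \<lambda>(p', s'). (p * p', s * s')) y \<in> T
      \<and> f x \<otimes>\<^bsub>LR.L\<^esub> f y = f ((case x of (p, s) \<Rightarrow> \<lambda>(p', s'). (p * p', s * s')) y)
      \<and> g x \<otimes>\<^bsub>LB.L\<^esub> g y = g ((case x of (p, s) \<Rightarrow> \<lambda>(p', s'). (p * p', s * s')) y)"
      by (simp add: T_def f_def g_def LR.mult_fraction LB_simps quot_mult simps)
  qed
  then obtain \<Phi> where \<Phi>: "\<Phi> \<in> ring_iso LR.L LB.L" "\<And>t. t \<in> T \<Longrightarrow> \<Phi> (f t) = g t" by blast
  have "\<Phi> (to_frac_field ?R (to_R_bar F p)) = to_frac_field B (\<phi> p)" if "p \<in> carrier P3" for p
    using \<Phi>(2)[of "(p, 1)"] that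
    by (simp add: T_def f_def g_def to_frac_field_def to_R_bar_eq quot_one B_ops)
  then show ?thesis using \<Phi>(1) unfolding frac_field_def by blast
qed

end

section \<open>Initial monomials\<close>

text \<open>The lowest coefficient in u has to be exactly a monomial in v, not just to start with
  one. This is stable under products, and it makes all other coefficients of that power of u
  zero.\<close>

definition has_init :: "complex poly poly \<Rightarrow> nat \<Rightarrow> nat \<Rightarrow> bool" where
  "has_init P i j \<longleftrightarrow> (\<exists>Q c. P = monom 1 i * Q \<and> coeff Q 0 = monom c j \<and> c \<noteq> 0)"

lemma has_init_mult:
  assumes "has_init P i j" "has_init P' i' j'"
  shows "has_init (P * P') (i + i') (j + j')"
proof -
  obtain Q c Q' c' where "P = monom 1 i * Q" "coeff Q 0 = monom c j" "c \<noteq> 0"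
    "P' = monom 1 i' * Q'" "coeff Q' 0 = monom c' j'" "c' \<noteq> 0"
    using assms by (auto simp: has_init_def)
  then have "P * P' = monom 1 (i + i') * (Q * Q')" "coeff (Q * Q') 0 = monom (c * c') (j + j')" "c * c' \<noteq> 0"
    by (simp_all add: mult_monom coeff_mult_0 algebra_simps flip: mult_monom[of 1 i 1 i', simplified])
  then show ?thesis unfolding has_init_def by blast
qed

lemma has_init_const: "c \<noteq> 0 \<Longrightarrow> has_init [:[:c:]:] 0 0"
  by (auto simp: has_init_def monom_0 intro!: exI[of _ "[:[:c:]:]"])

lemma has_init_power: "has_init P i j \<Longrightarrow> has_init (P ^ k) (k * i) (k * j)"
  using has_init_const[of 1] by (induction k) (auto simp: has_init_mult simp flip: one_pCons)

lemma has_init_nonzero: "has_init P i j \<Longrightarrow> P \<noteq> 0"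
  by (auto simp: has_init_def)

lemma has_init_coeff_below: "has_init P i j \<Longrightarrow> k < i \<Longrightarrow> coeff P k = 0"
  by (auto simp: has_init_def coeff_monom_mult)

lemma has_init_coeff: "has_init P i j \<Longrightarrow> \<exists>c. c \<noteq> 0 \<and> coeff P i = monom c j"
  by (auto simp: has_init_def coeff_monom_mult)

lemma eval_hom_poly_ring_3:
  "eval_hom \<iota> h p = (\<Sum>m \<in> Poly_Mapping.keys p. \<iota> (Poly_Mapping.lookup p m) *
     (h 1 ^ Poly_Mapping.lookup m 1 * h 2 ^ Poly_Mapping.lookup m 2 * h 3 ^ Poly_Mapping.lookup m 3))"
  if "p \<in> carrier (poly_ring 3)"
  unfolding eval_hom_def mon_eval_def[symmetric]
proof (intro sum.cong refl arg_cong2[of _ _ _ _ "(*)"])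
  fix m assume "m \<in> Poly_Mapping.keys p"
  then have "Poly_Mapping.keys m \<subseteq> {1, 2, 3}" using that by (force simp: mem_poly_ring)
  then show "mon_eval h m = h 1 ^ Poly_Mapping.lookup m 1 * h 2 ^ Poly_Mapping.lookup m 2 * h 3 ^ Poly_Mapping.lookup m 3"
    by (subst mon_eval_superset[of "{1, 2, 3}"]) (auto simp: algebra_simps)
qed

text \<open>The image of x^k y^i z^l starts at u^(\<rho>(N k + i)). For i < N, the exponents k and i
  are the base-N quotient and remainder of N k + i, so a tie in u leaves only l undetermined, and l
  is seen from the power of v because d > 0. Hence the initial monomials cannot cancel.\<close>

lemma initial_monomials_independent:
  assumes p: "p \<in> carrier (poly_ring 3)" and deg: "\<And>m. m \<in> Poly_Mapping.keys p \<Longrightarrow> Poly_Mapping.lookup m 2 < N"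
    and X: "has_init (bipoly (h 1)) (N * \<rho>) i" and Y: "has_init (bipoly (h 2)) \<rho> j"
    and Z: "has_init (bipoly (h 3)) 0 d" and "0 < \<rho>" "0 < d"
    and zero: "subst_poly h p = 0"
  shows "p = 0"
proof (rule ccontr)
  let ?l = Poly_Mapping.lookup
  assume "p \<noteq> 0"
  then have "Poly_Mapping.keys p \<noteq> {}"
    by (metis empty_iff in_keys_iff lookup_zero poly_mapping_eqI)
  define U where "U m = N * ?l m 1 + ?l m 2" for m :: "nat \<Rightarrow>\<^sub>0 nat"
  define V where "V m = ?l m 1 * i + ?l m 2 * j + ?l m 3 * d" for m :: "nat \<Rightarrow>\<^sub>0 nat"
  define T where "T m = [:[:?l p m:]:] * (bipoly (h 1) ^ ?l m 1 * bipoly (h 2) ^ ?l m 2 * bipoly (h 3) ^ ?l m 3)"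
    for m :: "nat \<Rightarrow>\<^sub>0 nat"
  \<comment> \<open>Minimality in u suffices: the other terms with the same order in u have a
    monomial in v with a different exponent as lowest coefficient.\<close>
  obtain M where M: "M \<in> Poly_Mapping.keys p" and min: "\<And>m. m \<in> Poly_Mapping.keys p \<Longrightarrow> U M \<le> U m"
    using ex_min_if_finite[of "U ` Poly_Mapping.keys p"] \<open>Poly_Mapping.keys p \<noteq> {}\<close>
    by (metis (no_types, lifting) finite_keys arg_min_if_finite linorder_not_less)
  have init: "has_init (T m) (U m * \<rho>) (V m)" if "m \<in> Poly_Mapping.keys p" for m
  proof -
    have "has_init (T m) (0 + (?l m 1 * (N * \<rho>) + ?l m 2 * \<rho> + ?l m 3 * 0)) (0 + (?l m 1 * i + ?l m 2 * j + ?l m 3 * d))"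
      unfolding T_def using that
      by (intro has_init_mult has_init_power X Y Z has_init_const) (auto simp: in_keys_iff)
    then show ?thesis by (simp add: U_def V_def algebra_simps)
  qed
  have "bipoly (subst_poly h p) = (\<Sum>m \<in> Poly_Mapping.keys p. T m)"
    by (simp only: eval_hom_poly_ring_3[OF p] bipoly_simps T_def)
  then have "(\<Sum>m \<in> Poly_Mapping.keys p. T m) = 0"
    by (simp add: zero bipoly_simps)
  then have "0 = (\<Sum>m \<in> Poly_Mapping.keys p. coeff (coeff (T m) (U M * \<rho>)) (V M))"
    by (metis coeff_0 coeff_sum)
  also have "\<dots> = (\<Sum>m \<in> {M}. coeff (coeff (T m) (U M * \<rho>)) (V M))"
  proof (rule sum.mono_neutral_right)
    show "\<forall>m \<in> Poly_Mapping.keys p - {M}. coeff (coeff (T m) (U M * \<rho>)) (V M) = 0"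
    proof
      fix m assume m: "m \<in> Poly_Mapping.keys p - {M}"
      show "coeff (coeff (T m) (U M * \<rho>)) (V M) = 0"
      proof (cases "U m = U M")
        case True
        have "?l m 1 = U m div N" "?l m 2 = U m mod N" "?l M 1 = U M div N" "?l M 2 = U M mod N"
          using deg[of m] deg[of M] m M by (auto simp: U_def)
        then have 12: "?l m 1 = ?l M 1" "?l m 2 = ?l M 2" using True by metis+
        have "V m \<noteq> V M"
        proof
          assume "V m = V M"
          then have 3: "?l m 3 = ?l M 3" using 12 \<open>0 < d\<close> by (simp add: V_def)
          have "m = M"
          proof (rule poly_mapping_eqI)
            fix k
            have "Poly_Mapping.keys m \<subseteq> {1..3}" "Poly_Mapping.keys M \<subseteq> {1..3}"
              using p m M by (auto simp: mem_poly_ring)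
            then have "?l m k = 0 \<and> ?l M k = 0" if "k \<notin> {1..3}"
              using that by (auto simp: in_keys_iff subset_iff)
            moreover have "{1..3::nat} = {1, 2, 3}" by auto
            ultimately show "?l m k = ?l M k" using 12 3 by (cases "k \<in> {1..3}") auto
          qed
          then show False using m by simp
        qed
        then show ?thesis using has_init_coeff[OF init[of m]] m True by auto
      next
        case False
        then have "U M * \<rho> < U m * \<rho>" using min[of m] m \<open>0 < \<rho>\<close> by auto
        then show ?thesis using has_init_coeff_below[OF init[of m]] m by auto
      qed
    qed
  qed (use M in auto)
  also have "\<dots> \<noteq> 0" using has_init_coeff[OF init[OF M]] by auto
  finally show False by simp
qed

lemma Var_power: "Var i ^ k = Poly_Mapping.single (Poly_Mapping.single i k) 1"
  by (induction k) (auto simp: Var_def mult_single simp flip: single_add single_one)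

text \<open>Long division by a polynomial monic in y: y^N is replaced by -G as long as the degree in
  y is at least N.\<close>

lemma division_in_second_variable:
  assumes G: "G \<in> carrier (poly_ring 3)" "\<And>m. m \<in> Poly_Mapping.keys G \<Longrightarrow> Poly_Mapping.lookup m 2 < N"
    and p: "p \<in> carrier (poly_ring 3)"
  shows "\<exists>g \<in> carrier (poly_ring 3). \<exists>r \<in> carrier (poly_ring 3).
    p = g * (Var 2 ^ N + G) + r \<and> (\<forall>m \<in> Poly_Mapping.keys r. Poly_Mapping.lookup m 2 < N)"
proof -
  let ?A = "carrier (poly_ring 3)"
  let ?F = "Var 2 ^ N + G"
  let ?l = Poly_Mapping.lookup
  \<comment> \<open>The set of polynomials that admit a division with remainder is closed under
    sums, so single monomials suffice.\<close>
  define D where "D = {p. \<exists>g \<in> ?A. \<exists>r \<in> ?A. p = g * ?F + r \<and> (\<forall>m \<in> Poly_Mapping.keys r. ?l m 2 < N)}"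
  have D_I: "g * ?F + r \<in> D" if "g \<in> ?A" "r \<in> ?A" "\<forall>m \<in> Poly_Mapping.keys r. ?l m 2 < N" for g r
    unfolding D_def mem_Collect_eq using that by (intro bexI[of _ g] bexI[of _ r]) auto
  have D_add: "p + q \<in> D" if "p \<in> D" "q \<in> D" for p q
  proof -
    obtain g r where p: "g \<in> ?A" "r \<in> ?A" "p = g * ?F + r" "\<forall>m \<in> Poly_Mapping.keys r. ?l m 2 < N"
      using \<open>p \<in> D\<close> unfolding D_def mem_Collect_eq by (elim bexE conjE)
    obtain g' r' where q: "g' \<in> ?A" "r' \<in> ?A" "q = g' * ?F + r'" "\<forall>m \<in> Poly_Mapping.keys r'. ?l m 2 < N"
      using \<open>q \<in> D\<close> unfolding D_def mem_Collect_eq by (elim bexE conjE)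
    have "p + q = (g + g') * ?F + (r + r')" unfolding p q by (simp add: algebra_simps)
    moreover have "\<forall>m \<in> Poly_Mapping.keys (r + r'). ?l m 2 < N" using keys_add[of r r'] p q by auto
    ultimately show ?thesis
      using D_I[of "g + g'" "r + r'"] add_in_poly_ring p(1,2) q(1,2) by simp
  qed
  have D_0: "0 \<in> D" using D_I[of 0 0] by simp
  have D_sum: "sum f I \<in> D" if "\<And>x. x \<in> I \<Longrightarrow> f x \<in> D" for f :: "(nat \<Rightarrow>\<^sub>0 nat) \<Rightarrow> cpoly" and I
    using that by (induction I rule: infinite_finite_induct) (auto intro: D_0 D_add)
  have multiple: "g * ?F \<in> D" if "g \<in> ?A" for g
    using D_I[of g 0] that by simp
  have "p \<in> D" if "p \<in> ?A" "\<And>m. m \<in> Poly_Mapping.keys p \<Longrightarrow> ?l m 2 < d" for p d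
    using that
  proof (induction d arbitrary: p)
    case 0
    then show ?case by (metis D_0 in_keys_iff lookup_zero not_less_zero poly_mapping_eqI)
  next
    case (Suc d)
    show ?case
    proof (subst cpoly_sum_monomials[of p], rule D_sum)
      fix m assume m: "m \<in> Poly_Mapping.keys p"
      let ?s = "Poly_Mapping.single m (?l p m)"
      have keys_m: "Poly_Mapping.keys m \<subseteq> {1..3}" using Suc.prems m by (auto simp: mem_poly_ring)
      then have s: "?s \<in> ?A" by (auto simp: mem_poly_ring split: if_splits)
      show "?s \<in> D"
      proof (cases "?l m 2 < N")
        case True
        then show ?thesis using D_I[of 0 ?s] s by simp
      next
        case False
        define m' where "m' = m - Poly_Mapping.single 2 N"
        let ?s' = "Poly_Mapping.single m' (?l p m)"
        have m_eq: "m = m' + Poly_Mapping.single 2 N"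
          using False by (intro poly_mapping_eqI) (auto simp: m'_def lookup_add lookup_minus lookup_single when_def)
        have "Poly_Mapping.keys m' \<subseteq> {1..3}"
          using keys_m by (auto simp: m_eq keys_pm_add_nat)
        then have s': "?s' \<in> ?A" by (auto simp: mem_poly_ring split: if_splits)
        \<comment> \<open>Replacing y^N by -G lowers the degree in y: a monomial of G has degree
          below N, so the product with \<open>m'\<close> stays below the degree of \<open>m\<close>,
          which is at most d.\<close>
        have "?l k 2 < d" if k: "k \<in> Poly_Mapping.keys (- (?s' * G))" for k
        proof -
          have "k \<in> Poly_Mapping.keys (?s' * G)" using k by (simp add: in_keys_iff)
          then obtain k' where "k' \<in> Poly_Mapping.keys G" "k = m' + k'"
            using keys_mult[of ?s' G] by (auto split: if_splits)
          then show ?thesis using G(2)[of k'] Suc.prems(2)[OF m]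
            by (simp add: m_eq lookup_add)
        qed
        then have "- (?s' * G) \<in> D" by (intro Suc.IH uminus_in_poly_ring mult_in_poly_ring s' G(1))
        moreover have "?s = ?s' * ?F + - (?s' * G)"
          by (subst (1) m_eq) (simp add: Var_power mult_single algebra_simps)
        ultimately show ?thesis using D_add multiple s' by metis
      qed
    qed
  qed
  moreover obtain d where "\<And>m. m \<in> Poly_Mapping.keys p \<Longrightarrow> ?l m 2 < d"
    using finite_nat_set_iff_bounded[of "(\<lambda>m. ?l m 2) ` Poly_Mapping.keys p"] by auto
  ultimately have "p \<in> D" using p by blast
  then show ?thesis by (simp add: D_def)
qed

section \<open>The relations and the exponents\<close>

text \<open>The defining recursion says that the defects of this three-term recursion at j and j+1
  add up to 0, and the defect at E-2 is 0. The three-term form is the one that matches z_(i-1)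
  z_(i+1) = z_i^(a_i).\<close>

lemma s_exp_rec:
  "j + 2 \<le> E \<Longrightarrow> s_exp a E j = int (a (j + 1)) * s_exp a E (j + 1) - s_exp a E (j + 2)"
proof (induction "E - j" arbitrary: j rule: less_induct)
  case less
  show ?case
  proof (cases "E = j + 2")
    case True
    then show ?thesis by (simp add: s_exp.simps)
  next
    case False
    then have "s_exp a E (j + 1) = int (a (j + 2)) * s_exp a E (j + 2) - s_exp a E (j + 3)"
      using less.prems less.hyps[of "j + 1"] by (simp add: numeral_eq_Suc)
    then show ?thesis
      using False less.prems by (subst s_exp.simps) (simp add: algebra_simps)
  qed
qed

text \<open>As a_(j+1) >= 2, s_j - s_(j+1) >= s_(j+1) - s_(j+2): read downwards from s_E = 0 and
  s_(E-1) = 1, the increments never decrease.\<close>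

lemma s_exp_mono:
  assumes "\<And>k. j < k \<Longrightarrow> k < E \<Longrightarrow> 2 \<le> a k"
  shows "0 \<le> s_exp a E (j + 1) \<and> s_exp a E (j + 1) \<le> s_exp a E j \<and> (j < E \<longrightarrow> 1 \<le> s_exp a E j)"
  using assms
proof (induction "E - j" arbitrary: j rule: less_induct)
  case less
  show ?case
  proof (cases "j + 2 \<le> E")
    case False
    then show ?thesis by (auto simp: s_exp.simps[of a E j] s_exp.simps[of a E "Suc j"])
  next
    case True
    then have IH: "0 \<le> s_exp a E (j + 2) \<and> s_exp a E (j + 2) \<le> s_exp a E (j + 1) \<and> 1 \<le> s_exp a E (j + 1)"
      using less.hyps[of "j + 1"] less.prems by simp
    have "2 * s_exp a E (j + 1) \<le> int (a (j + 1)) * s_exp a E (j + 1)"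
      using less.prems[of "j + 1"] True IH by (intro mult_right_mono) auto
    then show ?thesis using s_exp_rec[OF True, of a] IH by linarith
  qed
qed

definition tail_val :: "(nat \<Rightarrow> nat) \<Rightarrow> (nat \<Rightarrow> 'b::comm_ring_1) \<Rightarrow> nat \<Rightarrow> nat \<Rightarrow> 'b" where
  "tail_val a W l i = (\<Prod>k = l..i - 2. W k ^ (a k - 2)) * W (i - 1) ^ (a (i - 1) - 1)"

text \<open>Stated over any commutative ring, so that it applies both to the generators in C[u,v]
  and to points of C^e.\<close>

definition satisfies_relations :: "(nat \<Rightarrow> nat) \<Rightarrow> nat \<Rightarrow> (nat \<Rightarrow> 'b::comm_ring_1) \<Rightarrow> bool" where
  "satisfies_relations a e W \<longleftrightarrow>
     W 2 ^ 2 = W 1 * (W 3 ^ 2 + W 1 ^ (a 2 - 1)) \<and>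
     (\<forall>i. 4 \<le> i \<and> i \<le> e \<longrightarrow> W 1 * W i = W 2 * tail_val a W 3 i) \<and>
     (\<forall>i. 4 \<le> i \<and> i \<le> e \<longrightarrow> W 2 * W i = tail_val a W 3 i * (W 3 ^ 2 + W 1 ^ (a 2 - 1))) \<and>
     (\<forall>i. 4 \<le> i \<and> i \<le> e - 1 \<longrightarrow> W (i - 1) * W (i + 1) = W i ^ a i) \<and>
     (\<forall>j i. 4 \<le> j + 1 \<and> j + 1 < i - 1 \<and> i - 1 \<le> e - 1 \<longrightarrow>
        W j * W i = W (j + 1) ^ (a (j + 1) - 1) * tail_val a W (j + 2) i)"

lemma (in coeff_hom) eval_relations:
  "(\<forall>p \<in> riemenschneider_relations a e. eval_hom \<iota> W p = 0) \<longleftrightarrow> satisfies_relations a e W"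
proof -
  have [simp]: "eval_hom \<iota> W (tail_prod a l i) = tail_val a W l i" for l i
    by (simp add: tail_prod_def tail_val_def eval_hom_simps)
  have *: "(\<forall>p \<in> {f i | i. P i}. Q p) \<longleftrightarrow> (\<forall>i. P i \<longrightarrow> Q (f i))"
    "(\<forall>p \<in> {g j i | j i. R j i}. Q p) \<longleftrightarrow> (\<forall>j i. R j i \<longrightarrow> Q (g j i))"
    for f :: "nat \<Rightarrow> cpoly" and g :: "nat \<Rightarrow> nat \<Rightarrow> cpoly" and P R Q by blast+
  show ?thesis
    unfolding riemenschneider_relations_def satisfies_relations_def ball_Un *
    by (simp add: eval_hom_simps)
qed

section \<open>The chain relations and the equation F\<close>

locale hj_coefficients =
  fixes a :: "nat \<Rightarrow> nat" and e :: nat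
  assumes e_ge: "4 \<le> e" and a_ge: "\<And>j. 2 \<le> j \<Longrightarrow> j < e \<Longrightarrow> 2 \<le> a j"
begin

text \<open>The numbers s_j, hat s_j, \<alpha> and \<beta> as natural numbers, to serve as
  exponents. The bound a_j >= 2 keeps the truncated differences exact.\<close>

definition "s j = nat (s_exp a e j)"
definition "t j = nat (s_hat a e j)"
definition "A = 1 + (\<Sum>j = 3..e - 1. (a j - 2) * s j)"
definition "B = 1 + (\<Sum>j = 3..e - 2. (a j - 2) * t j)"

lemma s_int: "3 \<le> j \<Longrightarrow> s_exp a e j = int (s j)"
  using s_exp_mono[of "j - 1" e a] a_ge by (simp add: s_def)

lemma t_int: "3 \<le> j \<Longrightarrow> s_hat a e j = int (t j)"
  using s_exp_mono[of "j - 1" "e - 1" a] a_ge by (simp add: t_def s_hat_def)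

lemma s_exp_top: "s_exp a E E = 0" "s_exp a (Suc E) E = 1" "s_exp a (Suc (Suc E)) E = int (a (Suc E))"
  by (subst s_exp.simps, simp)+

lemma s_top: "s (e - 1) = 1" "s (e - 2) = a (e - 1)" "s e = 0"
  and t_top: "t (e - 1) = 0" "t (e - 2) = 1"
proof -
  obtain E where "e = Suc (Suc E)" using e_ge that[of "e - 2"] by simp
  then show "s (e - 1) = 1" "s (e - 2) = a (e - 1)" "s e = 0" "t (e - 1) = 0" "t (e - 2) = 1"
    unfolding s_def t_def s_hat_def by (simp_all add: s_exp_top)
qed

lemma s_pos: "3 \<le> j \<Longrightarrow> j < e \<Longrightarrow> 0 < s j"
  using s_exp_mono[of j e a] a_ge s_int[of j] by simp

lemma t_pos: "3 \<le> j \<Longrightarrow> j < e - 1 \<Longrightarrow> 0 < t j"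
  using s_exp_mono[of j "e - 1" a] a_ge t_int[of j] by (simp add: s_hat_def)

lemma s_rec: "3 \<le> j \<Longrightarrow> j + 2 \<le> e \<Longrightarrow> s j + s (j + 2) = a (j + 1) * s (j + 1)"
  using s_exp_rec[of j e a] s_int[of j] s_int[of "j + 1"] s_int[of "j + 2"]
  by (simp flip: of_nat_mult of_nat_add add: algebra_simps of_nat_eq_iff del: of_nat_add of_nat_mult)

lemma t_rec: "3 \<le> j \<Longrightarrow> j + 3 \<le> e \<Longrightarrow> t j + t (j + 2) = a (j + 1) * t (j + 1)"
  using s_exp_rec[of j "e - 1" a] t_int[of j] t_int[of "j + 1"] t_int[of "j + 2"]
  by (simp flip: of_nat_mult of_nat_add add: s_hat_def algebra_simps of_nat_eq_iff del: of_nat_add of_nat_mult)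

lemma alpha_eq: "alpha a e = int A"
  unfolding alpha_def A_def using a_ge by (auto simp: s_int of_nat_diff intro!: sum.cong)

lemma beta_eq: "beta a e = int B"
  unfolding beta_def B_def using a_ge by (auto simp: t_int of_nat_diff intro!: sum.cong)

lemma F_poly_eq: "F_poly a e = Var 2 ^ (2 * A + 2 * s 3)
    + Var 1 ^ (a 2 - 1) * Var 2 ^ (2 * A) * Var 3 ^ (2 * t 3) - Var 1 * Var 3 ^ (2 * B + 2 * t 3)"
proof -
  have "nat (2 * int A + 2 * int (s 3)) = 2 * A + 2 * s 3" "nat (2 * int B + 2 * int (t 3)) = 2 * B + 2 * t 3"
    "nat (2 * int A) = 2 * A" "nat (2 * int (t 3)) = 2 * t 3" by auto
  then show ?thesis by (simp add: F_poly_def alpha_eq beta_eq s_int t_int)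
qed

text \<open>Formally z_j = y^(s_j) / z^(hat s_j), because both exponents obey the recursion that
  z_(i-1) z_(i+1) = z_i^(a_i) imposes. The factor cancelled in the downward induction is
  y^(s_(j+2)), hence the hypothesis on y.\<close>

lemma chain_relation:
  fixes W :: "nat \<Rightarrow> 'b::idom"
  assumes rel: "\<And>i. 4 \<le> i \<Longrightarrow> i \<le> e - 1 \<Longrightarrow> W (i - 1) * W (i + 1) = W i ^ a i"
    and y: "W (e - 1) \<noteq> 0"
  shows "3 \<le> j \<Longrightarrow> j \<le> e - 1 \<Longrightarrow> W j * W e ^ t j = W (e - 1) ^ s j"
proof (induction "e - j" arbitrary: j rule: less_induct)
  case less
  consider "j = e - 1" | "j = e - 2" | "j + 3 \<le> e" using less.prems by linarith
  then show ?case
  proof cases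
    case 1
    show ?thesis by (simp only: 1 s_top t_top power_one_right power_0 mult_1_right)
  next
    case 2
    then have "4 \<le> e - 1" "e - 1 - 1 = e - 2" "e - 1 + 1 = e" using less.prems e_ge by auto
    then have "W (e - 2) * W e = W (e - 1) ^ a (e - 1)" using rel[of "e - 1"] by simp
    then show ?thesis by (simp only: 2 s_top t_top power_one_right)
  next
    case 3
    let ?y = "W (e - 1)" and ?z = "W e"
    have IH1: "W (j + 1) * ?z ^ t (j + 1) = ?y ^ s (j + 1)" and IH2: "W (j + 2) * ?z ^ t (j + 2) = ?y ^ s (j + 2)"
      using less.hyps[of "j + 1"] less.hyps[of "j + 2"] less.prems 3 by auto
    have "W j * ?z ^ t j * ?y ^ s (j + 2) = (W j * W (j + 2)) * ?z ^ (t j + t (j + 2))"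
      unfolding IH2[symmetric] by (simp add: power_add algebra_simps)
    also have "\<dots> = (W (j + 1) * ?z ^ t (j + 1)) ^ a (j + 1)"
      using rel[of "j + 1"] less.prems 3 t_rec[of j]
      by (simp add: power_mult_distrib mult.commute[of "a _"] power_mult)
    also have "\<dots> = ?y ^ s j * ?y ^ s (j + 2)"
      using s_rec[of j] less.prems 3 unfolding IH1
      by (simp add: mult.commute[of "a _"] flip: power_mult power_add)
    finally show ?thesis using y by simp
  qed
qed

text \<open>With s_(e-1) = 1, the last term of the sum and the leading 1 combine to a_(e-1) - 1, the
  exponent of z_(e-1) at the end of the tail product.\<close>

lemma A_eq: "A = (\<Sum>j = 3..e - 2. (a j - 2) * s j) + (a (e - 1) - 1)"
proof -
  have "{3..e - 1} = insert (e - 1) {3..e - 2}" "e - 1 \<notin> {3..e - 2}" using e_ge by auto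
  moreover have "2 \<le> a (e - 1)" using a_ge[of "e - 1"] e_ge by simp
  ultimately show ?thesis using s_top(1) by (simp add: A_def)
qed

text \<open>The origin of \<alpha> and \<beta>: the relation for z_1 z_e is multiplied by the powers
  of z_e that turn each factor z_j^(a_j-2) into a power of y. The 1 in \<beta> is the z_e already on
  the left.\<close>

lemma second_generator_relation:
  fixes W :: "nat \<Rightarrow> 'b::idom"
  assumes W: "satisfies_relations a e W" and y: "W (e - 1) \<noteq> 0"
  shows "W 2 * W (e - 1) ^ A = W 1 * W e ^ B"
proof -
  let ?y = "W (e - 1)" and ?z = "W e"
  have chain: "W j * ?z ^ t j = ?y ^ s j" if "3 \<le> j" "j \<le> e - 1" for j
    using chain_relation[of W j] W y that unfolding satisfies_relations_def by blast
  have "W 1 * ?z ^ B = (W 1 * ?z) * (\<Prod>j = 3..e - 2. (?z ^ t j) ^ (a j - 2))"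
    by (simp only: B_def power_add power_sum mult.commute[of "a _ - 2"] power_mult power_one_right mult.assoc)
  also have "W 1 * ?z = W 2 * tail_val a W 3 e"
    using W e_ge unfolding satisfies_relations_def by blast
  also have "W 2 * tail_val a W 3 e * (\<Prod>j = 3..e - 2. (?z ^ t j) ^ (a j - 2))
      = W 2 * ((\<Prod>j = 3..e - 2. (W j * ?z ^ t j) ^ (a j - 2)) * ?y ^ (a (e - 1) - 1))"
    by (simp add: tail_val_def power_mult_distrib prod.distrib algebra_simps)
  also have "(\<Prod>j = 3..e - 2. (W j * ?z ^ t j) ^ (a j - 2)) = (\<Prod>j = 3..e - 2. ?y ^ ((a j - 2) * s j))"
    by (intro prod.cong) (auto simp: chain mult.commute[of _ "s _"] power_mult)
  also have "\<dots> * ?y ^ (a (e - 1) - 1) = ?y ^ A"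
    by (simp add: A_eq power_add power_sum)
  finally show ?thesis by simp
qed

text \<open>Square the previous relation, insert the relation for z_2^2 and multiply by z^(2 hat
  s_3), so that z_3 becomes y^(s_3). A common factor x cancels.\<close>

lemma F_relation:
  fixes W :: "nat \<Rightarrow> 'b::idom"
  assumes W: "satisfies_relations a e W" and x: "W 1 \<noteq> 0" and y: "W (e - 1) \<noteq> 0"
  shows "W (e - 1) ^ (2 * A + 2 * s 3) + W 1 ^ (a 2 - 1) * W (e - 1) ^ (2 * A) * W e ^ (2 * t 3)
    = W 1 * W e ^ (2 * B + 2 * t 3)"
proof -
  let ?x = "W 1" and ?y = "W (e - 1)" and ?z = "W e"
  have "?x * (?x * ?z ^ (2 * B + 2 * t 3)) = (?x * ?z ^ B) ^ 2 * ?z ^ (2 * t 3)"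
    by (simp add: power_add power_mult power2_eq_square algebra_simps flip: power_mult_distrib)
  also have "\<dots> = W 2 ^ 2 * ?y ^ (2 * A) * ?z ^ (2 * t 3)"
    unfolding second_generator_relation[OF W y, symmetric]
    by (simp add: power_mult_distrib mult.commute[of 2] flip: power_mult)
  also have "W 2 ^ 2 = ?x * (W 3 ^ 2 + ?x ^ (a 2 - 1))"
    using W unfolding satisfies_relations_def by blast
  also have "?x * (W 3 ^ 2 + ?x ^ (a 2 - 1)) * ?y ^ (2 * A) * ?z ^ (2 * t 3)
      = ?x * ((W 3 * ?z ^ t 3) ^ 2 * ?y ^ (2 * A) + ?x ^ (a 2 - 1) * ?y ^ (2 * A) * ?z ^ (2 * t 3))"
    by (simp add: power_even_eq power_mult_distrib algebra_simps)
  also have "W 3 * ?z ^ t 3 = ?y ^ s 3"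
    using chain_relation[of W 3] W y e_ge unfolding satisfies_relations_def by simp
  finally have "?x * ?z ^ (2 * B + 2 * t 3)
      = (?y ^ s 3) ^ 2 * ?y ^ (2 * A) + ?x ^ (a 2 - 1) * ?y ^ (2 * A) * ?z ^ (2 * t 3)"
    using x by simp
  then show ?thesis by (simp add: power_add power_even_eq mult.commute)
qed

end

section \<open>Preimages of the points of the surface\<close>

lemma tail_val_rec: "l \<le> i - 2 \<Longrightarrow> tail_val a W l i = W l ^ (a l - 2) * tail_val a W (Suc l) i"
  by (simp add: tail_val_def prod.atLeast_Suc_atMost algebra_simps)

lemma tail_val_top: "2 \<le> i \<Longrightarrow> tail_val a W (i - 1) i = W (i - 1) ^ (a (i - 1) - 1)"
  by (simp add: tail_val_def)

context hj_coefficients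
begin

text \<open>By induction the product from l+1 on equals z_l z_i / z_(l+1). Together with z_l^(a_l-2)
  and the extra z_l this gives z_l^(a_l) z_i / z_(l+1) = z_(l-1) z_i.\<close>

lemma tail_val_telescope:
  fixes W :: "nat \<Rightarrow> 'b::idom"
  assumes rel: "\<And>i. 4 \<le> i \<Longrightarrow> i \<le> e - 1 \<Longrightarrow> W (i - 1) * W (i + 1) = W i ^ a i"
    and nz: "\<And>i. 3 \<le> i \<Longrightarrow> i \<le> e \<Longrightarrow> W i \<noteq> 0" and "i \<le> e"
  shows "4 \<le> l \<Longrightarrow> l \<le> i - 1 \<Longrightarrow> tail_val a W l i * W l = W (l - 1) * W i"
proof (induction "i - l" arbitrary: l rule: less_induct)
  case less
  have a_l: "W l * W l ^ (a l - 2) * W l = W l ^ a l" "W l ^ (a l - 1) * W l = W l ^ a l"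
  proof -
    have "2 \<le> a l" by (rule a_ge) (use less.prems \<open>i \<le> e\<close> in linarith)+
    then obtain k where "a l = k + 2" by (metis le_add_diff_inverse2)
    then show "W l * W l ^ (a l - 2) * W l = W l ^ a l" "W l ^ (a l - 1) * W l = W l ^ a l"
      by (simp_all add: algebra_simps)
  qed
  show ?case
  proof (cases "l = i - 1")
    case True
    then have "tail_val a W l i = W l ^ (a l - 1)" using tail_val_top[of i a W] less.prems by simp
    moreover have "l \<le> e - 1" "l + 1 = i" using True less.prems \<open>i \<le> e\<close> by linarith+
    ultimately show ?thesis using rel[of l] less.prems a_l(2) by simp
  next
    case False
    then have IH: "tail_val a W (Suc l) i * W (Suc l) = W l * W i"
      using less.hyps[of "Suc l"] less.prems by simp
    have "tail_val a W l i * W l * W (Suc l) = W l ^ (a l - 2) * W l * (tail_val a W (Suc l) i * W (Suc l))"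
      using False less.prems by (simp add: tail_val_rec algebra_simps)
    also have "\<dots> = W l ^ a l * W i"
      unfolding IH a_l(1)[symmetric] by (simp add: algebra_simps)
    also have "\<dots> = W (l - 1) * W i * W (Suc l)"
      using rel[of l] less.prems False \<open>i \<le> e\<close> by (simp add: algebra_simps)
    finally show ?thesis using nz[of "Suc l"] less.prems False \<open>i \<le> e\<close> by simp
  qed
qed

text \<open>The telescoping stops at index 4, because no relation has the form z_2 z_4 = z_3^(a_3);
  the power of z_3 is therefore kept.\<close>

lemma tail_val_3:
  fixes W :: "nat \<Rightarrow> 'b::idom"
  assumes rel: "\<And>i. 4 \<le> i \<Longrightarrow> i \<le> e - 1 \<Longrightarrow> W (i - 1) * W (i + 1) = W i ^ a i"
    and nz: "\<And>i. 3 \<le> i \<Longrightarrow> i \<le> e \<Longrightarrow> W i \<noteq> 0" and i: "4 \<le> i" "i \<le> e"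
  shows "tail_val a W 3 i * W 4 = W 3 ^ (a 3 - 1) * W i"
proof (cases "i = 4")
  case True
  then show ?thesis using tail_val_top[of 4 a W] by simp
next
  case False
  then have "tail_val a W 3 i = W 3 ^ (a 3 - 2) * tail_val a W 4 i"
    using i tail_val_rec[of 3 i a W] by (simp add: numeral_eq_Suc)
  moreover have "tail_val a W 4 i * W 4 = W 3 * W i"
    using tail_val_telescope[where W = W, OF rel nz i(2), of 4] i False by simp
  moreover have "a 3 - 1 = Suc (a 3 - 2)" using a_ge[of 3] e_ge by simp
  ultimately show ?thesis by (simp add: algebra_simps)
qed

text \<open>By \<open>tail_val_3\<close> the ratio of the tail product to z_i is z_3^(a_3-1)/z_4 for
  every i, so the relation for z_1 z_e yields those for all z_1 z_i. Those for z_2 z_i follow from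
  them and the equation for z_2^2 by cancelling z_2, and the last family is the telescoped
  product.\<close>

lemma satisfies_relations_torus:
  fixes W :: "nat \<Rightarrow> 'b::idom"
  assumes rel: "\<And>i. 4 \<le> i \<Longrightarrow> i \<le> e - 1 \<Longrightarrow> W (i - 1) * W (i + 1) = W i ^ a i"
    and nz: "\<And>i. 3 \<le> i \<Longrightarrow> i \<le> e \<Longrightarrow> W i \<noteq> 0" and x: "W 1 \<noteq> 0"
    and sq: "W 2 ^ 2 = W 1 * (W 3 ^ 2 + W 1 ^ (a 2 - 1))"
    and last: "W 1 * W e = W 2 * tail_val a W 3 e"
  shows "satisfies_relations a e W"
proof -
  have nz_e: "W e \<noteq> 0" and nz_4: "W 4 \<noteq> 0" using nz e_ge by auto
  then have nz_2: "W 2 \<noteq> 0" using x last by auto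
  have two: "W 1 * W i = W 2 * tail_val a W 3 i" if i: "4 \<le> i" "i \<le> e" for i
  proof -
    have t_i: "tail_val a W 3 i * W 4 = W 3 ^ (a 3 - 1) * W i"
      by (rule tail_val_3) (use rel nz i in blast)+
    have t_e: "tail_val a W 3 e * W 4 = W 3 ^ (a 3 - 1) * W e"
      by (rule tail_val_3) (use rel nz e_ge in blast)+
    have "W 2 * tail_val a W 3 i * (W 4 * W e) = W 2 * (tail_val a W 3 i * W 4) * W e"
      by (simp add: algebra_simps)
    also have "\<dots> = W 2 * (tail_val a W 3 e * W 4) * W i"
      unfolding t_i t_e by (simp add: algebra_simps)
    also have "\<dots> = (W 2 * tail_val a W 3 e) * (W 4 * W i)"
      by (simp add: algebra_simps)
    also have "\<dots> = W 1 * W i * (W 4 * W e)"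
      unfolding last[symmetric] by (simp add: algebra_simps)
    finally show ?thesis using nz_e nz_4 by simp
  qed
  have three: "W 2 * W i = tail_val a W 3 i * (W 3 ^ 2 + W 1 ^ (a 2 - 1))" if i: "4 \<le> i" "i \<le> e" for i
  proof -
    have "W 2 * (W 2 * W i) = W 1 * W i * (W 3 ^ 2 + W 1 ^ (a 2 - 1))"
      using sq by (simp add: power2_eq_square algebra_simps)
    also have "\<dots> = W 2 * (tail_val a W 3 i * (W 3 ^ 2 + W 1 ^ (a 2 - 1)))"
      unfolding two[OF i] by (simp add: algebra_simps)
    finally show ?thesis using nz_2 by simp
  qed
  have five: "W j * W i = W (j + 1) ^ (a (j + 1) - 1) * tail_val a W (j + 2) i"
    if ji: "4 \<le> j + 1" "j + 1 < i - 1" "i - 1 \<le> e - 1" for j i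
  proof -
    have "i \<le> e" using ji by simp
    then have t: "tail_val a W (j + 2) i * W (j + 2) = W (j + 1) * W i"
      using tail_val_telescope[where W = W, OF rel nz, of i "j + 2"] ji by simp
    have "j + 1 < e" using ji by linarith
    then have "a (j + 1) = Suc (a (j + 1) - 1)" using a_ge[of "j + 1"] ji by simp
    then have pow: "W (j + 1) ^ (a (j + 1) - 1) * W (j + 1) = W (j + 1) ^ a (j + 1)" by (metis power_Suc2)
    have "W (j + 1) ^ (a (j + 1) - 1) * tail_val a W (j + 2) i * W (j + 2) = W (j + 1) ^ a (j + 1) * W i"
      unfolding pow[symmetric] using t by (simp add: algebra_simps)
    also have "W (j + 1) ^ a (j + 1) = W j * W (j + 2)"
      using rel[of "j + 1"] ji by simp
    finally show ?thesis using nz[of "j + 2"] ji by (simp add: algebra_simps)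
  qed
  show ?thesis
    unfolding satisfies_relations_def using sq two three rel five by blast
qed

lemma torus_point:
  fixes x y z :: "'b::field"
  assumes "y \<noteq> 0" "z \<noteq> 0"
    and F: "y ^ (2 * A + 2 * s 3) + x ^ (a 2 - 1) * y ^ (2 * A) * z ^ (2 * t 3) = x * z ^ (2 * B + 2 * t 3)"
  shows "\<exists>W. satisfies_relations a e W \<and> W 1 = x \<and> W (e - 1) = y \<and> W e = z"
proof -
  \<comment> \<open>Obtained by solving z_j z^(t_j) = y^(s_j) and z_2 y^A = x z^B. At j = e-1 the
    formula gives y; at j = e it would give 1, so z is prescribed there.\<close>
  define W where "W j = (if j = 1 then x else if j = 2 then x * z ^ B / y ^ A else if j = e then z
    else y ^ s j / z ^ t j)" for j
  have W_1: "W 1 = x" and W_2: "W 2 = x * z ^ B / y ^ A" and W_e: "W e = z"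
    and W_j: "\<And>j. 3 \<le> j \<Longrightarrow> j \<le> e - 1 \<Longrightarrow> W j = y ^ s j / z ^ t j"
    using e_ge by (auto simp: W_def)
  have W_y: "W (e - 1) = y" using W_j[of "e - 1"] e_ge unfolding s_top t_top by simp
  \<comment> \<open>For x = 0 the equation reduces to y^N = 0, the middle term vanishing because a_2
    >= 2.\<close>
  have x: "x \<noteq> 0"
  proof
    assume "x = 0"
    moreover have "0 < a 2 - 1" using a_ge[of 2] e_ge by simp
    ultimately show False using F assms(1) by (simp add: zero_power)
  qed
  have "satisfies_relations a e W"
  proof (rule satisfies_relations_torus)
    show "W 1 \<noteq> 0" using x W_1 by simp
    show "W i \<noteq> 0" if "3 \<le> i" "i \<le> e" for i
      using that assms(1,2) W_e W_j[of i] by (cases "i = e") auto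
    show "W (i - 1) * W (i + 1) = W i ^ a i" if i: "4 \<le> i" "i \<le> e - 1" for i
    proof (cases "i = e - 1")
      case True
      have "W (e - 2) = y ^ a (e - 1) / z" using W_j[of "e - 2"] i True unfolding s_top t_top by simp
      moreover have "i - 1 = e - 2" "i + 1 = e" using True i by auto
      ultimately show ?thesis using W_e W_y assms(2) by (simp add: True)
    next
      case False
      then have "s (i - 1) + s (i + 1) = a i * s i" "t (i - 1) + t (i + 1) = a i * t i"
        using s_rec[of "i - 1"] t_rec[of "i - 1"] i by simp_all
      moreover have "W (i - 1) * W (i + 1) = y ^ (s (i - 1) + s (i + 1)) / z ^ (t (i - 1) + t (i + 1))"
        using W_j[of "i - 1"] W_j[of "i + 1"] i False by (simp add: power_add)
      ultimately show ?thesis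
        using W_j[of i] i by (simp add: power_divide mult.commute[of "a i"] power_mult)
    qed
    have W_3: "W 3 = y ^ s 3 / z ^ t 3" using W_j[of 3] e_ge by simp
    have "W 2 ^ 2 = x * (x * z ^ (2 * B + 2 * t 3)) / (y ^ (2 * A) * z ^ (2 * t 3))"
      using assms(1,2) by (simp add: W_2 power_add power_even_eq power_divide power2_eq_square)
    also have "\<dots> = x * ((y ^ s 3 / z ^ t 3) ^ 2 + x ^ (a 2 - 1))"
      unfolding F[symmetric] using assms(1,2) by (simp add: power_add power_even_eq power_divide field_simps)
    finally show "W 2 ^ 2 = W 1 * (W 3 ^ 2 + W 1 ^ (a 2 - 1))" unfolding W_1 W_3 .
    have "tail_val a W 3 e = (\<Prod>j = 3..e - 2. (y ^ s j) ^ (a j - 2) / (z ^ t j) ^ (a j - 2)) * y ^ (a (e - 1) - 1)"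
      unfolding tail_val_def W_y
      by (intro arg_cong2[of _ _ _ _ "(*)"] prod.cong refl) (auto simp: W_j power_divide)
    also have "\<dots> = y ^ A / (\<Prod>j = 3..e - 2. (z ^ t j) ^ (a j - 2))"
      by (simp only: A_eq power_add power_sum mult.commute[of "a _ - 2"] power_mult prod_dividef times_divide_eq_left)
    finally have tail: "tail_val a W 3 e * (\<Prod>j = 3..e - 2. (z ^ t j) ^ (a j - 2)) = y ^ A"
      using assms(2) by simp
    have z_B: "z ^ B = z * (\<Prod>j = 3..e - 2. (z ^ t j) ^ (a j - 2))"
      by (simp only: B_def power_add power_sum mult.commute[of "a _ - 2"] power_mult power_one_right)
    have "tail_val a W 3 e * z ^ B = z * y ^ A"
      unfolding z_B tail[symmetric] by (rule mult.left_commute)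
    then show "W 1 * W e = W 2 * tail_val a W 3 e"
      unfolding W_1 W_2 W_e using assms(1) by (simp add: field_simps)
  qed
  then show ?thesis using W_1 W_y W_e by blast
qed

lemma tail_val_eq_0: "W (i - 1) = 0 \<Longrightarrow> 3 \<le> i \<Longrightarrow> i \<le> e \<Longrightarrow> tail_val a W l i = 0"
proof -
  assume i: "W (i - 1) = 0" "3 \<le> i" "i \<le> e"
  then have "2 \<le> a (i - 1)" by (intro a_ge) linarith+
  then have "0 < a (i - 1) - 1" by simp
  then show ?thesis unfolding tail_val_def i(1) by (simp add: zero_power del: One_nat_def)
qed

text \<open>All of z_3, ..., z_(e-1) are put to 0, which kills every tail product. The first
  relation then asks for a square root of x^(a_2) as z_2; if z is nonzero, then x = 0 and z_2 = 0,
  so the products with z_e vanish too.\<close>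

lemma boundary_point:
  fixes x z :: complex
  assumes "x = 0 \<or> z = 0"
  shows "\<exists>W. satisfies_relations a e W \<and> W 1 = x \<and> W (e - 1) = 0 \<and> W e = z"
proof -
  define W where "W j = (if j = 1 then x else if j = 2 then csqrt (x ^ a 2) else if j = e then z else 0)" for j
  have W: "W 1 = x" "W 2 = csqrt (x ^ a 2)" "W e = z" "\<And>j. 3 \<le> j \<Longrightarrow> j \<noteq> e \<Longrightarrow> W j = 0"
    using e_ge by (auto simp: W_def)
  have a2: "2 \<le> a 2" using a_ge[of 2] e_ge by simp
  then have "W 2 ^ 2 = x * x ^ (a 2 - 1)"
    by (simp add: W(2) flip: power_Suc)
  moreover have "x * W i = 0" "W 2 * W i = 0" if "3 \<le> i" for i
    using W assms that a2 by (cases "i = e"; auto)+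
  moreover have "tail_val a W l i = 0" if "4 \<le> i" "i \<le> e" for l i
    using tail_val_eq_0[of W i l] W(4)[of "i - 1"] that by simp
  moreover have "0 < a i" if "4 \<le> i" "i \<le> e - 1" for i
    using a_ge[of i] that e_ge by linarith
  ultimately have "satisfies_relations a e W"
    using W e_ge unfolding satisfies_relations_def by auto
  then show ?thesis using W(1,3) W(4)[of "e - 1"] e_ge by auto
qed

lemma surjectivity:
  fixes x y z :: complex
  assumes F: "y ^ (2 * A + 2 * s 3) + x ^ (a 2 - 1) * y ^ (2 * A) * z ^ (2 * t 3) = x * z ^ (2 * B + 2 * t 3)"
  shows "\<exists>W. satisfies_relations a e W \<and> W 1 = x \<and> W (e - 1) = y \<and> W e = z"
proof -
  have "0 < A" "0 < B" by (simp_all add: A_def B_def)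
  consider "y = 0" | "y \<noteq> 0" "z \<noteq> 0" | "y \<noteq> 0" "z = 0" by blast
  then show ?thesis
  proof cases
    case 1
    then show ?thesis using F \<open>0 < A\<close> boundary_point[of x z] by (auto simp: zero_power)
  next
    case 2
    then show ?thesis using F torus_point by blast
  next
    case 3
    \<comment> \<open>With z = 0 and hat s_3 > 0 the equation would read y^N = 0. Since hat s_3 > 0
      as soon as e > 4, only e = 4 remains.\<close>
    have "t 3 = 0"
    proof (rule ccontr)
      assume "t 3 \<noteq> 0"
      then show False using F 3 \<open>0 < B\<close> by (simp add: zero_power)
    qed
    then have e4: "e = 4" using t_pos[of 3] e_ge by linarith
    then have s3: "s 3 = 1" using s_top(1) by simp
    have "y ^ (2 * A) * (y ^ 2 + x ^ (a 2 - 1)) = 0"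
      using F 3 \<open>0 < B\<close> by (simp add: \<open>t 3 = 0\<close> s3 power_add power2_eq_square zero_power algebra_simps)
    then have eq: "y ^ 2 + x ^ (a 2 - 1) = 0" using 3 by simp
    \<comment> \<open>Here y^2 + x^(a_2-1) = 0 is the second factor in the relation for z_2^2, which
      makes z_2 = 0 the right choice.\<close>
    define W where "W j = (if j = 1 then x else if j = 3 then y else 0)" for j :: nat
    have "W 1 = x" "W 2 = 0" "W 3 = y" "W 4 = 0" by (auto simp: W_def)
    moreover have "\<And>i. 4 \<le> i \<Longrightarrow> i \<le> e \<Longrightarrow> i = 4" using e4 by simp
    ultimately have "satisfies_relations a e W"
      unfolding satisfies_relations_def using eq e4 by auto
    then show ?thesis using e4 3 by (auto simp: W_def intro!: exI[of _ W])
  qed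
qed

end

section \<open>The exponents of the generators and the continued fraction\<close>

lemma hj_fraction_gt_1: "xs \<noteq> [] \<Longrightarrow> (\<And>c. c \<in> set xs \<Longrightarrow> 2 \<le> c) \<Longrightarrow> 1 < hj_fraction xs"
proof (induction xs rule: hj_fraction.induct)
  case (3 c d cs)
  then have "1 < hj_fraction (d # cs)" "2 \<le> c" by auto
  then have "1 / hj_fraction (d # cs) < 1" "(2::rat) \<le> of_nat c"
    by (auto simp: of_nat_le_iff[of 2, simplified])
  then show ?case by simp
qed (auto simp: of_nat_less_iff[of 1, simplified])

lemma rec_seq_top: "rec_seq a t2 t3 t4 2 = t2" "rec_seq a t2 t3 t4 3 = t3" "rec_seq a t2 t3 t4 4 = t4"
  "5 \<le> j \<Longrightarrow> rec_seq a t2 t3 t4 j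
    = int (a (j - 1)) * rec_seq a t2 t3 t4 (j - 1) - rec_seq a t2 t3 t4 (j - 2)"
  by (subst rec_seq.simps; simp)+

context hj_coefficients
begin

text \<open>Serves to show that z_e contains v_2 with positive exponent, so its initial monomial has
  a positive power of v.\<close>

lemma c_seq_ge: "4 \<le> j \<Longrightarrow> j \<le> e \<Longrightarrow> c_seq a (j - 1) \<le> c_seq a j \<and> 1 \<le> c_seq a j"
proof (induction j rule: nat_induct_at_least)
  case base
  then show ?case by (simp add: c_seq_def rec_seq_top)
next
  case (Suc j)
  note step = Suc
  have "2 * c_seq a j \<le> int (a j) * c_seq a j"
    using a_ge[of j] step by (intro mult_right_mono) auto
  moreover have "c_seq a (Suc j) = int (a j) * c_seq a j - c_seq a (j - 1)"
    using step unfolding c_seq_def by (subst rec_seq_top(4)) auto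
  moreover have "c_seq a (j - 1) \<le> c_seq a j" "1 \<le> c_seq a j" using step by auto
  ultimately show ?case unfolding diff_Suc_1 by linarith
qed

text \<open>The sequence n, n-q, r_3, r_4, ... consists of the remainders of the Hirzebruch-Jung
  algorithm for n/(n-q): r_3 = a_2 (n-q) - n, and r_4 = a_3 r_3 - (n-q) because r_2 - r_3 = n-q.
  Thus n-q, not r_2, precedes r_3, and quotients of consecutive remainders are the tails of the
  continued fraction.\<close>

lemma r_seq_hj:
  assumes "q < n" and hj: "hj_fraction (map a [2..<e]) = of_nat n / of_nat (n - q)"
  shows "3 \<le> j \<Longrightarrow> j < e \<Longrightarrow> 0 < r_seq n q a j \<and>
    hj_fraction (map a [j..<e]) * of_int (r_seq n q a j)
      = of_int (if j = 3 then int (n - q) else r_seq n q a (j - 1))"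
proof (induction j rule: nat_induct_at_least)
  let ?h = "\<lambda>j. hj_fraction (map a [j..<e])"
  have gt1: "1 < ?h j" if "2 \<le> j" "j < e" for j
    using that a_ge by (intro hj_fraction_gt_1) auto
  have h_rec: "?h j = of_nat (a j) - 1 / ?h (Suc j)" if "Suc j < e" for j
    using that by (simp add: upt_conv_Cons)
  {
    case base
    define m where "m = n - q"
    then have m: "0 < m" "int n = int m + int q" using assms(1) by auto
    have "?h 2 = of_nat (a 2) - 1 / ?h 3" using h_rec[of 2] e_ge by (simp add: numeral_eq_Suc)
    moreover have "1 < ?h 3" using gt1[of 3] e_ge by simp
    ultimately have h3: "?h 3 * (of_nat (a 2) - ?h 2) = 1" by simp
    have "r_seq n q a 3 = int (a 2) * int m - int n"
      using m assms(1) by (simp add: r_seq_def rec_seq_top m_def of_nat_diff algebra_simps)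
    then have "of_int (r_seq n q a 3) = of_nat (a 2) * of_nat m - (of_nat n :: rat)"
      by simp
    also have "\<dots> = (of_nat (a 2) - ?h 2) * of_nat m"
      unfolding hj m_def[symmetric] using m(1) by (simp add: field_simps)
    finally have r3: "of_int (r_seq n q a 3) = (of_nat (a 2) - ?h 2) * (of_nat m :: rat)" .
    then have eq: "?h 3 * of_int (r_seq n q a 3) = of_nat m"
      using h3 by (simp flip: mult.assoc)
    moreover have "0 < r_seq n q a 3"
    proof -
      have "0 < ?h 3 * of_int (r_seq n q a 3)" using eq m by simp
      then show ?thesis using \<open>1 < ?h 3\<close> by (simp add: zero_less_mult_iff)
    qed
    ultimately show ?case by (simp add: m_def)
  next
    case (Suc j)
    note step = Suc
    define r where "r = r_seq n q a"
    \<comment> \<open>The remainder that precedes \<open>r j\<close>.\<close>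
    define p where "p = (if j = 3 then int (n - q) else r (j - 1))"
    have IH: "0 < r j" "?h j * of_int (r j) = of_int p"
      using step by (auto simp: r_def p_def)
    have "r (Suc j) = int (a j) * r j - p"
    proof (cases "j = 3")
      case True
      then show ?thesis using assms(1) by (simp add: r_def p_def r_seq_def rec_seq_top Let_def of_nat_diff algebra_simps)
    next
      case False
      then show ?thesis using step unfolding r_def p_def r_seq_def Let_def by (subst rec_seq_top(4)) auto
    qed
    then have "of_int (r (Suc j)) = of_nat (a j) * of_int (r j) - (of_int p :: rat)" by simp
    then have "of_int (r (Suc j)) = (of_nat (a j) - ?h j) * (of_int (r j) :: rat)"
      using IH(2) by (simp add: algebra_simps)
    moreover have h: "1 < ?h (Suc j)" using gt1[of "Suc j"] step by simp
    moreover have "?h j = of_nat (a j) - 1 / ?h (Suc j)" using h_rec step by simp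
    ultimately have eq: "?h (Suc j) * of_int (r (Suc j)) = of_int (r j)" by simp
    moreover have "0 < r (Suc j)"
    proof -
      have "0 < ?h (Suc j) * of_int (r (Suc j))" using eq IH by simp
      then show ?thesis using h by (simp add: zero_less_mult_iff)
    qed
    ultimately show ?case using step by (simp add: r_def)
  }
qed

text \<open>The last tail of the continued fraction is the integer a_(e-1), so the algorithm ends
  with remainder 0 at index e.\<close>

lemma r_seq_top:
  assumes "q < n" and hj: "hj_fraction (map a [2..<e]) = of_nat n / of_nat (n - q)"
  shows "0 < r_seq n q a (e - 1)" "r_seq n q a e = 0"
proof -
  define p where "p = (if e - 1 = 3 then int (n - q) else r_seq n q a (e - 1 - 1))"
  have *: "0 < r_seq n q a (e - 1)" "hj_fraction (map a [e - 1..<e]) * of_int (r_seq n q a (e - 1)) = of_int p"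
    using r_seq_hj[OF assms, of "e - 1"] e_ge unfolding p_def by auto
  then show "0 < r_seq n q a (e - 1)" by simp
  have "[e - 1..<e] = [e - 1]" using e_ge by (simp add: upt_conv_Cons)
  then have "(of_int (int (a (e - 1)) * r_seq n q a (e - 1)) :: rat) = of_int p"
    using *(2) by simp
  then have p: "int (a (e - 1)) * r_seq n q a (e - 1) = p" by (simp only: of_int_eq_iff)
  show "r_seq n q a e = 0"
  proof (cases "e = 4")
    case True
    then show ?thesis using p assms(1)
      by (simp add: p_def r_seq_def rec_seq_top Let_def of_nat_diff algebra_simps)
  next
    case False
    then have "r_seq n q a e = int (a (e - 1)) * r_seq n q a (e - 1) - r_seq n q a (e - 2)"
      using e_ge unfolding r_seq_def Let_def by (subst rec_seq_top(4)) auto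
    moreover have "e - 1 \<noteq> 3" "e - 1 - 1 = e - 2" using False e_ge by auto
    ultimately show ?thesis using p by (simp only: p_def if_False)
  qed
qed

end

section \<open>The dihedral singularities\<close>

lemma subst_relations: "(\<forall>p \<in> riemenschneider_relations a e. subst_poly W p = 0) \<longleftrightarrow> satisfies_relations a e W"
  by (rule subst.eval_relations)

lemma proj3_simps [simp]: "proj3 e w 1 = w 1" "proj3 e w 2 = w (e - 1)" "proj3 e w 3 = w e"
  by (simp_all add: proj3_def)

lemma proj3_affine: "proj3 e w \<in> affine_space 3"
  by (simp add: affine_space_def proj3_def)

lemma tail_prod_in_poly_ring:
  "1 \<le> l \<Longrightarrow> 2 \<le> i \<Longrightarrow> i \<le> k + 1 \<Longrightarrow> tail_prod a l i \<in> carrier (poly_ring k)"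
  unfolding tail_prod_def by (intro mult_in_poly_ring prod_in_poly_ring power_in_poly_ring Var_in_poly_ring) auto

lemma relations_in_poly_ring:
  assumes "4 \<le> e"
  shows "riemenschneider_relations a e \<subseteq> carrier (poly_ring e)"
  unfolding riemenschneider_relations_def using assms
  by (auto intro!: diff_in_poly_ring add_in_poly_ring mult_in_poly_ring power_in_poly_ring Var_in_poly_ring
      tail_prod_in_poly_ring)

lemma has_init_v1: "has_init (bipoly (Var 1 * Var 2)) 1 1"
  unfolding has_init_def bipoly_simps
  by (intro exI[of _ "[:[:0, 1:]:]"] exI[of _ 1]) (simp add: monom_altdef)

text \<open>Since q > 0, putting u = 0 leaves only the power of v, up to sign.\<close>

lemma has_init_v23:
  assumes "0 < q"
  shows "has_init (bipoly (Var 1 ^ (2 * q) + (- 1) ^ k * Var 2 ^ (2 * q))) 0 (2 * q)"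
proof -
  have "coeff (bipoly (Var 1 ^ (2 * q) + (- 1) ^ k * Var 2 ^ (2 * q))) 0 = monom ((- 1) ^ k) (2 * q)"
    using assms
    by (simp add: bipoly_simps poly_const_pow coeff_mult_0 coeff_0_power monom_altdef
        minus_one_power_iff)
  then show ?thesis unfolding has_init_def
    by (intro exI[of _ "bipoly _"] exI[of _ "(- 1) ^ k"] conjI) auto
qed

lemma has_init_bipoly_mult:
    "has_init (bipoly p) i j \<Longrightarrow> has_init (bipoly p') i' j' \<Longrightarrow> has_init (bipoly (p * p')) (i + i') (j + j')"
  and has_init_bipoly_power: "has_init (bipoly p) i j \<Longrightarrow> has_init (bipoly (p ^ k)) (k * i) (k * j)"
  by (simp_all add: bipoly_simps has_init_mult has_init_power)

lemma has_init_Const: "c \<noteq> 0 \<Longrightarrow> has_init P i j \<Longrightarrow> has_init ([:[:c:]:] * P) i j"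
  using has_init_mult[OF has_init_const] by fastforce

locale dihedral_generators = hj_coefficients a e for a e +
  fixes n q :: nat and \<epsilon> :: "nat \<Rightarrow> complex" and z :: "nat \<Rightarrow> cpoly"
  assumes q: "0 < q" "q < n" and hj: "hj_fraction (map a [2..<e]) = of_nat n / of_nat (n - q)"
    and gens: "riemenschneider_generators \<epsilon> n q a e z"
begin

lemma a2: "2 \<le> a 2"
  using a_ge[of 2] e_ge by simp

lemma A_pos: "0 < A" and B_pos: "0 < B"
  by (simp_all add: A_def B_def)

abbreviation "R \<equiv> invariant_ring \<epsilon> n q"
abbreviation "F \<equiv> F_poly a e"
abbreviation "h \<equiv> proj3 e z"

lemma carrier_R: "carrier R = subst_poly z ` carrier (poly_ring e)"
  using gens by (simp add: riemenschneider_generators_def)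

lemma relation_ideal_eq: "relation_ideal e z = Idl\<^bsub>poly_ring e\<^esub> (riemenschneider_relations a e)"
  using gens by (simp add: riemenschneider_generators_def)

lemma z_in_poly_ring: "1 \<le> j \<Longrightarrow> j \<le> e \<Longrightarrow> z j \<in> carrier (poly_ring 2)"
proof -
  assume "1 \<le> j" "j \<le> e"
  then have "subst_poly z (Var j) \<in> carrier R" unfolding carrier_R by (intro imageI) auto
  then show ?thesis by (simp add: invariant_ring_def)
qed

lemma relations_in_ideal: "riemenschneider_relations a e \<subseteq> relation_ideal e z"
  unfolding relation_ideal_eq
  using ring.genideal_self[OF cring.axioms(1)[OF cring_poly_ring] relations_in_poly_ring[OF e_ge]] .

lemma relations_z: "satisfies_relations a e z"
  unfolding subst_relations[symmetric] using relations_in_ideal by (auto simp: relation_ideal_def)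

text \<open>Polynomials vanishing at w form an ideal, so it is enough that it contains the
  generating equations.\<close>

lemma embedded_spec_iff: "w \<in> embedded_spec e z \<longleftrightarrow> w \<in> affine_space e \<and> satisfies_relations a e w"
proof -
  let ?I = "{p \<in> carrier (poly_ring e). eval_at w p = 0}"
  have "ideal ?I (poly_ring e)"
    by (rule ideal_poly_ringI) (auto simp: eval_at.eval_hom_simps)
  then have "relation_ideal e z \<subseteq> ?I" if "riemenschneider_relations a e \<subseteq> ?I"
    unfolding relation_ideal_eq
    using ring.genideal_minimal[OF cring.axioms(1)[OF cring_poly_ring]] that by blast
  then have "(\<forall>p \<in> relation_ideal e z. eval_at w p = 0) \<longleftrightarrow> (\<forall>p \<in> riemenschneider_relations a e. eval_at w p = 0)"
    using relations_in_ideal relations_in_poly_ring[OF e_ge, of a] by blast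
  then show ?thesis
    by (simp add: embedded_spec_def zero_locus_def eval_at.eval_relations)
qed

lemma bipoly_z: "1 \<le> j \<Longrightarrow> j \<le> e \<Longrightarrow> \<exists>\<kappa>. \<kappa> \<noteq> 0 \<and> bipoly (z j) = [:[:\<kappa>:]:] * bipoly (raw_gen n q a j)"
proof -
  assume "1 \<le> j" "j \<le> e"
  then obtain \<kappa> where "\<kappa> \<noteq> 0" "z j = Const \<kappa> * raw_gen n q a j"
    using gens unfolding riemenschneider_generators_def by (meson atLeastAtMost_iff)
  then show ?thesis by (auto simp: bipoly_simps)
qed

section \<open>Initial monomials of the generators and the kernel\<close>

lemma init_z1: "has_init (bipoly (z 1)) (2 * (n - q)) (2 * (n - q))"
proof -
  have "raw_gen n q a 1 = (Var 1 * Var 2) ^ (2 * (n - q))" by (simp add: raw_gen_def)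
  then have "has_init (bipoly (raw_gen n q a 1)) (2 * (n - q) * 1) (2 * (n - q) * 1)"
    by (simp only: has_init_bipoly_power[OF has_init_v1])
  then show ?thesis using bipoly_z[of 1] e_ge has_init_Const by auto
qed

lemma init_zj:
  assumes "2 \<le> j" "j \<le> e"
  shows "has_init (bipoly (z j)) (nat (r_seq n q a j))
    (nat (r_seq n q a j) + 2 * q * nat (c_seq a j) + 2 * q * nat (d_seq a j))"
proof -
  have raw: "raw_gen n q a j = (Var 1 * Var 2) ^ nat (r_seq n q a j)
      * (Var 1 ^ (2 * q) + (- 1) ^ a 2 * Var 2 ^ (2 * q)) ^ nat (c_seq a j)
      * (Var 1 ^ (2 * q) + (- 1) ^ (a 2 - 1) * Var 2 ^ (2 * q)) ^ nat (d_seq a j)"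
    using assms by (simp add: raw_gen_def)
  have "has_init (bipoly (raw_gen n q a j)) (nat (r_seq n q a j) * 1 + nat (c_seq a j) * 0 + nat (d_seq a j) * 0)
      (nat (r_seq n q a j) * 1 + nat (c_seq a j) * (2 * q) + nat (d_seq a j) * (2 * q))"
    unfolding raw using q(1)
    by (intro has_init_bipoly_mult has_init_bipoly_power has_init_v1 has_init_v23)
  then show ?thesis using bipoly_z[of j] assms has_init_Const by (auto simp: algebra_simps)
qed

abbreviation "N \<equiv> 2 * A + 2 * s 3"
definition "\<rho> = nat (r_seq n q a (e - 1))"

lemma \<rho>_pos: "0 < \<rho>"
  using r_seq_top[OF q(2) hj] by (simp add: \<rho>_def)

lemma init_y: "\<exists>j. has_init (bipoly (z (e - 1))) \<rho> j"
proof -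
  have "2 \<le> e - 1" using e_ge by linarith
  then show ?thesis using init_zj[of "e - 1"] unfolding \<rho>_def by auto
qed

lemma init_z: "\<exists>d > 0. has_init (bipoly (z e)) 0 d"
proof -
  have "1 \<le> c_seq a e" using c_seq_ge[of e] e_ge by simp
  then have "0 < 2 * q * nat (c_seq a e) + 2 * q * nat (d_seq a e)" using q(1) by simp
  moreover have "has_init (bipoly (z e)) 0 (2 * q * nat (c_seq a e) + 2 * q * nat (d_seq a e))"
    using init_zj[of e] e_ge r_seq_top(2)[OF q(2) hj] by simp
  ultimately show ?thesis by blast
qed

lemma z_nonzero: "z 1 \<noteq> 0" "z (e - 1) \<noteq> 0" "z e \<noteq> 0"
  using init_z1 init_y init_z by (auto dest: has_init_nonzero simp: bipoly_simps(1))

lemma F_relation_z: "z (e - 1) ^ N + z 1 ^ (a 2 - 1) * z (e - 1) ^ (2 * A) * z e ^ (2 * t 3)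
    = z 1 * z e ^ (2 * B + 2 * t 3)"
  using F_relation[OF relations_z z_nonzero(1,2)] .

text \<open>Compare the lowest powers of u in the three terms of F(h) = 0. The middle term starts
  beyond u^(2(n-q)), because a_2 >= 2 and A \<rho> > 0, so the two outer terms have to start at the
  same power.\<close>

lemma N_\<rho>: "N * \<rho> = 2 * (n - q)"
proof -
  obtain j where Y: "has_init (bipoly (z (e - 1))) \<rho> j" using init_y by blast
  obtain d where Z: "has_init (bipoly (z e)) 0 d" using init_z by blast
  define P1 where "P1 = bipoly (z (e - 1)) ^ N"
  define P2 where "P2 = bipoly (z 1) ^ (a 2 - 1) * bipoly (z (e - 1)) ^ (2 * A) * bipoly (z e) ^ (2 * t 3)"
  define P3 where "P3 = bipoly (z 1) * bipoly (z e) ^ (2 * B + 2 * t 3)"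
  have sum: "P1 + P2 = P3"
    using arg_cong[OF F_relation_z, of bipoly] by (simp only: bipoly_simps P1_def P2_def P3_def)
  have i1: "has_init P1 (N * \<rho>) (N * j)"
    unfolding P1_def by (rule has_init_power[OF Y])
  have i2: "has_init P2 ((a 2 - 1) * (2 * (n - q)) + 2 * A * \<rho> + 2 * t 3 * 0)
      ((a 2 - 1) * (2 * (n - q)) + 2 * A * j + 2 * t 3 * d)"
    unfolding P2_def by (intro has_init_mult has_init_power init_z1 Y Z)
  have i3: "has_init P3 (2 * (n - q) + (2 * B + 2 * t 3) * 0) (2 * (n - q) + (2 * B + 2 * t 3) * d)"
    unfolding P3_def by (intro has_init_mult has_init_power init_z1 Z)
  have "1 * (2 * (n - q)) \<le> (a 2 - 1) * (2 * (n - q))" using a2 by (intro mult_right_mono) auto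
  moreover have "0 < 2 * A * \<rho>" using A_pos \<rho>_pos by simp
  ultimately have "2 * (n - q) < (a 2 - 1) * (2 * (n - q)) + 2 * A * \<rho> + 2 * t 3 * 0" by linarith
  note below = has_init_coeff_below[OF i2 this] has_init_coeff_below[OF i2 order.strict_trans[OF _ this]]
  show ?thesis
  proof (rule linorder_cases[of "N * \<rho>" "2 * (n - q)"])
    assume less: "N * \<rho> < 2 * (n - q)"
    then have "coeff P1 (N * \<rho>) = 0"
      using below(2)[OF less] has_init_coeff_below[OF i3, of "N * \<rho>"] sum by (metis add.right_neutral coeff_add mult_0_right)
    then show ?thesis using has_init_coeff[OF i1] by auto
  next
    assume less: "2 * (n - q) < N * \<rho>"
    then have "coeff P3 (2 * (n - q)) = 0"
      using below(1) has_init_coeff_below[OF i1, of "2 * (n - q)"] sum by (metis add.right_neutral coeff_add)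
    then show ?thesis using has_init_coeff[OF i3] by auto
  qed
qed

lemma F_in_poly_ring: "F \<in> carrier (poly_ring 3)"
  unfolding F_poly_eq
  by (intro diff_in_poly_ring add_in_poly_ring mult_in_poly_ring power_in_poly_ring Var_in_poly_ring) auto

lemma subst_F: "subst_poly h F = 0"
  using F_relation_z by (simp add: F_poly_eq subst.eval_hom_simps proj3_simps[simplified])

lemma kernel:
  assumes p: "p \<in> carrier (poly_ring 3)"
  shows "subst_poly h p = 0 \<longleftrightarrow> (\<exists>g \<in> carrier (poly_ring 3). p = g * F)"
proof
  define G where "G = Var 1 ^ (a 2 - 1) * Var 2 ^ (2 * A) * Var 3 ^ (2 * t 3) - Var 1 * Var 3 ^ (2 * B + 2 * t 3)"
  have F_eq: "F = Var 2 ^ N + G" by (simp add: F_poly_eq G_def)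
  have G: "G \<in> carrier (poly_ring 3)"
    unfolding G_def by (intro diff_in_poly_ring add_in_poly_ring mult_in_poly_ring power_in_poly_ring Var_in_poly_ring) auto
  \<comment> \<open>This makes the degree 2A of the middle term in y smaller than N.\<close>
  have s3: "0 < s 3" using s_pos[of 3] e_ge by simp
  have deg_G: "Poly_Mapping.lookup m 2 < N" if "m \<in> Poly_Mapping.keys G" for m
  proof -
    have monomials: "Var 1 ^ i * Var 2 ^ j * Var 3 ^ k
          = Poly_Mapping.single (Poly_Mapping.single 1 i + Poly_Mapping.single 2 j + Poly_Mapping.single 3 k) 1"
        "Var 1 ^ i * Var 3 ^ k = Poly_Mapping.single (Poly_Mapping.single 1 i + Poly_Mapping.single 3 k) 1" for i j k
      by (simp_all add: Var_power mult_single)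
    \<comment> \<open>\<open>Var 1\<close> is written as a first power to fit the pattern of
      \<open>monomials\<close>.\<close>
    have "G = Var 1 ^ (a 2 - 1) * Var 2 ^ (2 * A) * Var 3 ^ (2 * t 3) - Var 1 ^ 1 * Var 3 ^ (2 * B + 2 * t 3)"
      by (simp add: G_def)
    note this[unfolded monomials]
    then have "m = Poly_Mapping.single 1 (a 2 - 1) + Poly_Mapping.single 2 (2 * A) + Poly_Mapping.single 3 (2 * t 3)
        \<or> m = Poly_Mapping.single 1 1 + Poly_Mapping.single 3 (2 * B + 2 * t 3)"
      using that by (auto simp: in_keys_iff lookup_minus lookup_single when_def split: if_splits)
    then show ?thesis using s3 by (auto simp: lookup_add lookup_single)
  qed
  assume zero: "subst_poly h p = 0"
  obtain g r where gr: "g \<in> carrier (poly_ring 3)" "r \<in> carrier (poly_ring 3)" "p = g * F + r"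
      "\<forall>m \<in> Poly_Mapping.keys r. Poly_Mapping.lookup m 2 < N"
    using division_in_second_variable[OF G deg_G p] unfolding F_eq by blast
  have "subst_poly h r = 0"
    using zero unfolding gr(3) by (simp add: subst.eval_hom_simps subst_F)
  moreover obtain j where "has_init (bipoly (h 2)) \<rho> j" using init_y unfolding proj3_simps by blast
  moreover obtain d where "0 < d" "has_init (bipoly (h 3)) 0 d" using init_z unfolding proj3_simps by blast
  moreover have "has_init (bipoly (h 1)) (N * \<rho>) (2 * (n - q))" using init_z1 unfolding proj3_simps N_\<rho> .
  ultimately have "r = 0"
    using initial_monomials_independent[of r N h \<rho> "2 * (n - q)"] gr(2,4) \<rho>_pos by blast
  then show "\<exists>g \<in> carrier (poly_ring 3). p = g * F" using gr(1,3) by auto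
next
  assume "\<exists>g \<in> carrier (poly_ring 3). p = g * F"
  then show "subst_poly h p = 0" by (auto simp: subst.eval_hom_simps subst_F)
qed

lemma eval_F: "eval_at w F = w 2 ^ N + w 1 ^ (a 2 - 1) * w 2 ^ (2 * A) * w 3 ^ (2 * t 3) - w 1 * w 3 ^ (2 * B + 2 * t 3)"
  by (simp add: F_poly_eq eval_at.eval_hom_simps)

sublocale hypersurface_parametrization F h
proof
  show "eval_at (origin 3) F = 0"
    using A_pos B_pos by (simp add: eval_F origin_def zero_power)
qed (use F_in_poly_ring kernel in auto)

section \<open>The image of the projection and its vanishing ideal\<close>

lemma eval_proj3:
  assumes "p \<in> carrier (poly_ring 3)" "subst_poly h p = 0" "w \<in> embedded_spec e z"
  shows "eval_at (proj3 e w) p = 0"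
proof -
  \<comment> \<open>This is p in the coordinates Z_1, Z_(e-1), Z_e of C^e; it is a relation between
    the generators because p(h) = 0.\<close>
  let ?P = "subst_poly (proj3 e Var) p"
  have P: "?P \<in> carrier (poly_ring e)"
    using assms(1) e_ge by (intro subst_in_poly_ring[of p 3]) (auto simp: proj3_def intro!: Var_in_poly_ring)
  have comp: "subst_poly z ?P = subst_poly h p" "eval_at w ?P = eval_at (proj3 e w) p"
    unfolding subst.eval_hom_subst eval_at.eval_hom_subst
    by (rule eval_hom_cong[OF assms(1)]; auto simp: proj3_def)+
  then have "?P \<in> relation_ideal e z" using P assms(2) by (simp add: relation_ideal_def)
  then show ?thesis using assms(3) comp by (simp add: embedded_spec_def zero_locus_def)
qed

lemma X_bar_eq: "X_bar e z = zero_locus 3 {F}"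
proof (intro equalityI subsetI)
  fix w assume "w \<in> X_bar e z"
  then show "w \<in> zero_locus 3 {F}"
    using eval_proj3[OF F_in_poly_ring subst_F] proj3_affine by (auto simp: X_bar_def zero_locus_def)
next
  fix w assume w: "w \<in> zero_locus 3 {F}"
  then have "w 2 ^ N + w 1 ^ (a 2 - 1) * w 2 ^ (2 * A) * w 3 ^ (2 * t 3) = w 1 * w 3 ^ (2 * B + 2 * t 3)"
    by (simp add: zero_locus_def eval_F)
  then obtain W where W: "satisfies_relations a e W" "W 1 = w 1" "W (e - 1) = w 2" "W e = w 3"
    using surjectivity by blast
  \<comment> \<open>Points of affine space are extensional functions, so the values outside 1..e are
    made undefined.\<close>
  define W' where "W' = (\<lambda>i \<in> {1..e}. W i)"
  have W': "W' i = W i" if "1 \<le> i" "i \<le> e" for i using that by (simp add: W'_def)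
  have "satisfies_relations a e W'"
    using W(1) eval_hom_cong[of _ e W' W] W' relations_in_poly_ring[OF e_ge, of a]
    unfolding eval_at.eval_relations[symmetric] by (metis (no_types, lifting) subsetD)
  then have "W' \<in> embedded_spec e z"
    by (simp add: embedded_spec_iff W'_def affine_space_def)
  moreover have "proj3 e W' = w"
  proof
    fix i
    have "i \<notin> {1..3} \<Longrightarrow> w i = undefined" using w by (auto simp: zero_locus_def affine_space_def PiE_def extensional_def)
    moreover have "i \<in> {1..3} \<Longrightarrow> i = 1 \<or> i = 2 \<or> i = 3" by auto
    ultimately show "proj3 e W' i = w i"
      using W(2-4) W' e_ge by (cases "i \<in> {1..3}") (auto simp: proj3_def)
  qed
  ultimately show "w \<in> X_bar e z" unfolding X_bar_def by blast
qed

lemma vanishing_X_bar: "vanishing_ideal 3 (X_bar e z) = {p \<in> carrier (poly_ring 3). subst_poly h p = 0}"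
proof (intro equalityI subsetI)
  fix p assume "p \<in> {p \<in> carrier (poly_ring 3). subst_poly h p = 0}"
  then show "p \<in> vanishing_ideal 3 (X_bar e z)"
    using eval_proj3 by (auto simp: vanishing_ideal_def X_bar_def)
next
  fix p assume "p \<in> vanishing_ideal 3 (X_bar e z)"
  then have p: "p \<in> carrier (poly_ring 3)" and van: "\<And>w. w \<in> embedded_spec e z \<Longrightarrow> eval_at (proj3 e w) p = 0"
    by (auto simp: vanishing_ideal_def X_bar_def)
  have h: "h i \<in> carrier (poly_ring 2)" if "1 \<le> i" "i \<le> 3" for i
    using that z_in_poly_ring[of 1] z_in_poly_ring[of "e - 1"] z_in_poly_ring[of e] e_ge by (auto simp: proj3_def)
  have "subst_poly h p = 0"
  proof (rule poly_eq_0_if_vanishing)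
    show "subst_poly h p \<in> carrier (poly_ring 2)" using subst_in_poly_ring[OF p] h by blast
    fix u
    define w where "w = (\<lambda>i \<in> {1..e}. eval_at u (z i))"
    have "eval_at w g = eval_at u (subst_poly z g)" if "g \<in> carrier (poly_ring e)" for g
      unfolding eval_at.eval_hom_subst using that by (rule eval_hom_cong) (simp add: w_def)
    then have "w \<in> embedded_spec e z"
      by (auto simp: embedded_spec_def zero_locus_def relation_ideal_def w_def affine_space_def)
    then have "0 = eval_at (proj3 e w) p" using van by simp
    also have "\<dots> = eval_at u (subst_poly h p)"
      unfolding eval_at.eval_hom_subst using p
      by (rule eval_hom_cong) (use e_ge in \<open>auto simp: w_def proj3_def\<close>)
    finally show "eval_at u (subst_poly h p) = 0" by simp
  qed
  then show "p \<in> {p \<in> carrier (poly_ring 3). subst_poly h p = 0}" using p by simp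
qed

section \<open>The invariants as rational functions of the three coordinates\<close>

lemma cring_R: "cring R"
proof (rule cring_of_type_operations)
  \<comment> \<open>Closure is read off from R being the image of a substitution, not from the group
    action.\<close>
  show "1 \<in> carrier R" unfolding carrier_R by (intro image_eqI[of _ _ 1]) auto
  fix x assume "x \<in> carrier R"
  then obtain p where p: "p \<in> carrier (poly_ring e)" "x = subst_poly z p" unfolding carrier_R by blast
  then show "- x \<in> carrier R"
    unfolding carrier_R by (intro image_eqI[of _ _ "- p"]) (auto simp: subst.eval_hom_simps)
  fix y assume "y \<in> carrier R"
  then obtain p' where p': "p' \<in> carrier (poly_ring e)" "y = subst_poly z p'" unfolding carrier_R by blast
  show "x + y \<in> carrier R"
    unfolding carrier_R using p p' by (intro image_eqI[of _ _ "p + p'"]) (auto simp: subst.eval_hom_simps)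
  show "x * y \<in> carrier R"
    unfolding carrier_R using p p' by (intro image_eqI[of _ _ "p * p'"]) (auto simp: subst.eval_hom_simps)
qed (simp_all add: invariant_ring_def poly_ring_def)

lemma subst_h_in_R: "p \<in> carrier (poly_ring 3) \<Longrightarrow> subst_poly h p \<in> carrier R"
proof -
  assume p: "p \<in> carrier (poly_ring 3)"
  have "subst_poly (proj3 e Var) p \<in> carrier (poly_ring e)"
    using p e_ge by (intro subst_in_poly_ring[of p 3]) (auto simp: proj3_def intro!: Var_in_poly_ring)
  moreover have "subst_poly z (subst_poly (proj3 e Var) p) = subst_poly h p"
    unfolding subst.eval_hom_subst
    by (rule eval_hom_cong[OF p]; auto simp: proj3_def)
  ultimately show ?thesis unfolding carrier_R by (metis imageI)
qed

text \<open>The elements of C[u,v] that lie in the fraction field of the image of \<phi>, with the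
  denominator cleared.\<close>

definition quotients :: "cpoly set" where
  "quotients = {f. \<exists>p \<in> carrier (poly_ring 3). \<exists>g \<in> carrier (poly_ring 3). subst_poly h g \<noteq> 0 \<and> f * subst_poly h g = subst_poly h p}"

lemma quotientsI:
  "p \<in> carrier (poly_ring 3) \<Longrightarrow> g \<in> carrier (poly_ring 3) \<Longrightarrow> subst_poly h g \<noteq> 0 \<Longrightarrow>
    f * subst_poly h g = subst_poly h p \<Longrightarrow> f \<in> quotients"
  unfolding quotients_def by blast

lemma quotientsE:
  assumes "f \<in> quotients"
  obtains p g where "p \<in> carrier (poly_ring 3)" "g \<in> carrier (poly_ring 3)" "subst_poly h g \<noteq> 0"
    "f * subst_poly h g = subst_poly h p"
  using assms unfolding quotients_def by blast

lemma quotients_subst: "p \<in> carrier (poly_ring 3) \<Longrightarrow> subst_poly h p \<in> quotients"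
  by (rule quotientsI[of p 1]) auto

lemma quotients_add: "f \<in> quotients \<Longrightarrow> f' \<in> quotients \<Longrightarrow> f + f' \<in> quotients"
proof (elim quotientsE)
  fix p g p' g'
  assume *: "p \<in> carrier (poly_ring 3)" "g \<in> carrier (poly_ring 3)" "subst_poly h g \<noteq> 0" "f * subst_poly h g = subst_poly h p"
    "p' \<in> carrier (poly_ring 3)" "g' \<in> carrier (poly_ring 3)" "subst_poly h g' \<noteq> 0" "f' * subst_poly h g' = subst_poly h p'"
  show ?thesis
  proof (rule quotientsI[of "p * g' + p' * g" "g * g'"])
    show "(f + f') * subst_poly h (g * g') = subst_poly h (p * g' + p' * g)"
      unfolding subst.eval_hom_simps *(4,8)[symmetric] by (simp add: algebra_simps)
  qed (use * in \<open>auto simp: subst.eval_hom_simps\<close>)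
qed

lemma quotients_mult: "f \<in> quotients \<Longrightarrow> f' \<in> quotients \<Longrightarrow> f * f' \<in> quotients"
proof (elim quotientsE)
  fix p g p' g'
  assume *: "p \<in> carrier (poly_ring 3)" "g \<in> carrier (poly_ring 3)" "subst_poly h g \<noteq> 0" "f * subst_poly h g = subst_poly h p"
    "p' \<in> carrier (poly_ring 3)" "g' \<in> carrier (poly_ring 3)" "subst_poly h g' \<noteq> 0" "f' * subst_poly h g' = subst_poly h p'"
  show ?thesis
  proof (rule quotientsI[of "p * p'" "g * g'"])
    show "f * f' * subst_poly h (g * g') = subst_poly h (p * p')"
      unfolding subst.eval_hom_simps *(4,8)[symmetric] by (simp add: algebra_simps)
  qed (use * in \<open>auto simp: subst.eval_hom_simps\<close>)
qed

lemma z_in_quotients: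
  assumes "1 \<le> j" "j \<le> e"
  shows "z j \<in> quotients"
proof -
  note h_simps = subst.eval_hom_simps subst.eval_hom_Var proj3_simps
  consider "j = 1" | "j = 2" | "3 \<le> j" "j \<le> e - 1" | "j = e" using assms by linarith
  then show ?thesis
  proof cases
    case 1
    then show ?thesis using quotients_subst[of "Var 1"] by (simp add: Var_in_poly_ring proj3_simps[simplified])
  next
    case 2
    show ?thesis unfolding 2
    proof (rule quotientsI[of "Var 1 * Var 3 ^ B" "Var 2 ^ A"])
      show "z 2 * subst_poly h (Var 2 ^ A) = subst_poly h (Var 1 * Var 3 ^ B)"
        unfolding h_simps using second_generator_relation[OF relations_z z_nonzero(2)] .
      show "subst_poly h (Var 2 ^ A) \<noteq> 0" unfolding h_simps using z_nonzero by simp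
    qed (auto intro!: mult_in_poly_ring power_in_poly_ring Var_in_poly_ring)
  next
    case 3
    show ?thesis
    proof (rule quotientsI[of "Var 2 ^ s j" "Var 3 ^ t j"])
      show "z j * subst_poly h (Var 3 ^ t j) = subst_poly h (Var 2 ^ s j)"
        unfolding h_simps using chain_relation[of z j] relations_z z_nonzero(2) 3
        unfolding satisfies_relations_def by blast
      show "subst_poly h (Var 3 ^ t j) \<noteq> 0" unfolding h_simps using z_nonzero by simp
    qed (auto intro!: mult_in_poly_ring power_in_poly_ring Var_in_poly_ring)
  next
    case 4
    then show ?thesis using quotients_subst[of "Var 3"] by (simp add: Var_in_poly_ring)
  qed
qed

text \<open>Every invariant is a polynomial in the z_j, and \<open>quotients\<close> is a subring
  containing the constants and the z_j.\<close>

lemma R_sub_quotients: "carrier R \<subseteq> quotients"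
proof
  have Const: "Const c \<in> quotients" for c using quotients_subst[of "Const c"] by simp
  have one: "1 \<in> quotients" using quotients_subst[of 1] by simp
  have zero: "0 \<in> quotients" using quotients_subst[of 0] by simp
  have power: "f ^ k \<in> quotients" if "f \<in> quotients" for f k
    using that by (induction k) (auto intro: one quotients_mult)
  have prod: "prod f I \<in> quotients" if "\<And>i. i \<in> I \<Longrightarrow> f i \<in> quotients" for f :: "nat \<Rightarrow> cpoly" and I
    using that by (induction I rule: infinite_finite_induct) (auto intro: one quotients_mult)
  have sum: "sum f I \<in> quotients" if "\<And>i. i \<in> I \<Longrightarrow> f i \<in> quotients" for f :: "(nat \<Rightarrow>\<^sub>0 nat) \<Rightarrow> cpoly" and I
    using that by (induction I rule: infinite_finite_induct) (auto intro: zero quotients_add)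
  fix f assume "f \<in> carrier R"
  then obtain p where p: "p \<in> carrier (poly_ring e)" "f = subst_poly z p" unfolding carrier_R by blast
  show "f \<in> quotients"
    unfolding p(2) eval_hom_def
  proof (intro sum quotients_mult Const prod power)
    fix m i assume "m \<in> Poly_Mapping.keys p" "i \<in> Poly_Mapping.keys m"
    then have "i \<in> {1..e}" using p(1) unfolding mem_poly_ring by blast
    then show "z i \<in> quotients" using z_in_quotients by simp
  qed
qed

end

theorem theorem4p8:
  fixes n q e :: nat
    and a :: "nat \<Rightarrow> nat"
    and \<epsilon> :: "nat \<Rightarrow> complex"
    and z :: "nat \<Rightarrow> cpoly"
  assumes "coprime n q" and "1 < q" and "q < n"
    and "is_hj_expansion (of_nat n / of_nat (n - q)) a e"
    and "4 \<le> e"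
    and "\<And>k. 0 < k \<Longrightarrow> primitive_root k (\<epsilon> k)"
    and "riemenschneider_generators \<epsilon> n q a e z"
  shows "X_bar e z = zero_locus 3 {F_poly a e}
    \<and> (\<exists>\<Psi> \<in> ring_iso (R_bar (F_poly a e)) (local_ring_at 3 (X_bar e z) (origin 3)).
          \<forall>p \<in> carrier (poly_ring 3). \<Psi> (to_R_bar (F_poly a e) p) = germ_at 3 (X_bar e z) (origin 3) p)
    \<and> domain (R_bar (F_poly a e))
    \<and> (\<exists>\<Phi> \<in> ring_iso (frac_field (R_bar (F_poly a e))) (frac_field (invariant_ring \<epsilon> n q)).
          \<forall>p \<in> carrier (poly_ring 3).
            \<Phi> (to_frac_field (R_bar (F_poly a e)) (to_R_bar (F_poly a e) p))
              = to_frac_field (invariant_ring \<epsilon> n q) (subst_poly (proj3 e z) p))"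
proof -
  interpret dihedral_generators a e n q \<epsilon> z
    using assms by unfold_locales (auto simp: is_hj_expansion_def)
  show ?thesis
  proof (intro conjI)
    show "X_bar e z = zero_locus 3 {F_poly a e}" by (rule X_bar_eq)
    show "domain (R_bar (F_poly a e))" by (rule domain_R_bar)
    show "\<exists>\<Psi> \<in> ring_iso (R_bar (F_poly a e)) (local_ring_at 3 (X_bar e z) (origin 3)).
        \<forall>p \<in> carrier (poly_ring 3). \<Psi> (to_R_bar (F_poly a e) p) = germ_at 3 (X_bar e z) (origin 3) p"
      by (rule local_ring_iso[OF vanishing_X_bar])
    show "\<exists>\<Phi> \<in> ring_iso (frac_field (R_bar (F_poly a e))) (frac_field (invariant_ring \<epsilon> n q)).
          \<forall>p \<in> carrier (poly_ring 3).
            \<Phi> (to_frac_field (R_bar (F_poly a e)) (to_R_bar (F_poly a e) p))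
              = to_frac_field (invariant_ring \<epsilon> n q) (subst_poly (proj3 e z) p)"
    proof (rule frac_field_iso[OF _ _ _ _ cring_R subst_h_in_R])
      fix f assume "f \<in> carrier R"
      then show "\<exists>p \<in> carrier (poly_ring 3). \<exists>g \<in> carrier (poly_ring 3).
          subst_poly h g \<noteq> 0 \<and> f * subst_poly h g = subst_poly h p"
        using R_sub_quotients unfolding quotients_def by blast
    qed (simp_all add: invariant_ring_def poly_ring_def)
  qed
qed

end
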